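(* Let $g,h\in \mathrm{SO}(2,1)^0$ be such that $G=\langle g,h\rangle$ is a transversal Schottky group with Schottky generators $g,h$, normalized so that $\mathfrak O[\mathsf x^-_g,\mathsf x^-_h,\mathsf x^+_g]$ (this can always be achieved by replacing $h$ by $h^{-1}$ if necessary), and suppose that $\langle g,h\rangle$ has Property C. Then for every integer $n\geq 1$ there exist translational parts $\mathsf v_g,\mathsf v_h\in\mathbb R^{2,1}$ such that the affine deformation $\Gamma=\langle\gamma,\eta\rangle$ of $G$ generated by $\gamma(x)=g(x)+\mathsf v_g$ and $\eta(x)=h(x)+\mathsf v_h$ does not act properly on $\mathbb A^{2,1}$, while the Margulis invariant satisfies $\alpha(\omega)>0$ for every non-trivial $\omega\in\Gamma$ of word length at most $n$ in $\gamma^{\pm1},\eta^{\pm1}$.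
   Context: $\mathbb R^{2,1}$ is $\mathbb R^3$ with the bilinear form $\mathbb B(\mathsf x,\mathsf y)=x_1y_1+x_2y_2-x_3y_3$, and $\mathbb A^{2,1}$ is the affine space modelled on it. A vector $\mathsf x$ is spacelike, timelike or lightlike if $\mathbb B(\mathsf x,\mathsf x)$ is positive, negative or zero; a non-zero lightlike vector is future-pointing if its third coordinate is positive. $\mathcal F$ (written $\mathfrak F$) denotes the set of future-pointing lightlike rays (topologically a circle); closures of subsets of $\mathfrak F$ are taken in $\mathfrak F$. $\mathrm{SO}(2,1)^0$ is the identity component of the isometry group $\mathrm O(2,1)$ of $\mathbb B$; it acts on $\mathfrak F$. For $\mathsf v\in\mathbb R^{2,1}$, $\mathsf v^\perp=\{\mathsf x:\mathbb B(\mathsf x,\mathsf v)=0\}$. For $\mathsf x,\mathsf y,\mathsf z\in\mathfrak F$ (represented by any future-pointing vectors on the rays), $\mathfrak O[\mathsf x,\mathsf y,\mathsf z]$ means $\det[\mathsf x\ \mathsf y\ \mathsf z]>0$. Hyperbolic elements: $g\in\mathrm{SO}(2,1)^0$ is hyperbolic if it has three distinct eigenvalues; these are $\lambda_g,1,\lambda_g^{-1}$ with $0<\lambda_g<1$. Then $\mathsf x^-_g$ and $\mathsf x^+_g$ denote the future-pointing lightlike eigenvectors of Euclidean length one for $\lambda_g$ and $\lambda_g^{-1}$ respectively, and $\mathsf x^0_g$ is the $1$-eigenvector with $\mathbb B(\mathsf x^0_g,\mathsf x^0_g)=1$ such that $(\mathsf x^0_g,\mathsf x^-_g,\mathsf x^+_g)$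 is a positively oriented basis. Schottky groups: a conical interval is a connected subset of $\mathfrak F$. $\langle g_1,\dots,g_m\rangle\subset\mathrm{SO}(2,1)^0$ is a Schottky group with Schottky generators $g_1,\dots,g_m$ if there are $2m$ pairwise disjoint closed conical intervals $A_i^{\pm}$ (a Schottky system; also written $A^\pm_{g_i}$) with $g_i(A_i^-)=\mathrm{cl}(\mathfrak F- A_i^+)$ for all $i$. Such a group is free on the $g_i$, discrete, and all its non-identity elements are hyperbolic. A Schottky group $\langle g,h\rangle$ is transversal if the planes $(\mathsf x^0_g)^\perp$ and $(\mathsf x^0_h)^\perp$ intersect in a timelike line. Words: a reduced word $w$ in the generators and their inverses is cyclically reduced if $w^2$ (concatenation) is also reduced. Property C (for a transversal Schottky group $\langle g,h\rangle$ with $\mathfrak O[\mathsf x^-_g,\mathsf x^-_h,\mathsf x^+_g]$ and Schottky system $A_g^\pm,A_h^\pm$): let $W^+$ (resp. $W^-$) be the set of all cyclically reduced words of the form $gh^ig^{-1}w$ (resp. $gh^{-i}g^{-1}w$) with $i\geq 1$ an integer and $w$ a word (the displayed expression being reduced as written). Let $A$ be the closed conical interval contained in $A^+_g$ and bounded by the rays of $\mathsf x^+_{gh}$ and $g(\mathsf x^+_h)$. Then $\langle g,h\rangle$ has Property C if for every (future-pointing lightlike) $\mathsf x\in A$, $$-\mathbb B(\mathsf x,\mathsf x^0_{w_1})<\mathbb B(\mathsf x,\mathsf x^0_{w_2})\quad\text{for all } w_1\in W^+,\ w_2\in W^-.$$ Affine deformations and the Margulis invariant: for $\gamma(x)=g(x)+\mathsf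 v_g$ an affine isometry of $\mathbb A^{2,1}$, $g$ is its linear part and $\mathsf v_g$ its translational part. An affine deformation of $G$ is a group of affine isometries with linear part $G$, obtained by assigning translational parts to the free generators of $G$ (so projection to the linear part is an isomorphism onto $G$). If the linear part $g$ of $\gamma$ is hyperbolic, the Margulis invariant is $\alpha(\gamma)=\mathbb B(\gamma(p)-p,\mathsf x^0_g)$, which is independent of $p\in\mathbb A^{2,1}$. The group $\Gamma$ acts properly on $\mathbb A^{2,1}$ if for every compact $K\subset\mathbb A^{2,1}$ the set $\{\omega\in\Gamma:\omega K\cap K\neq\emptyset\}$ is finite. *)

theory Defs
  imports "HOL-Analysis.Analysis"
begin

text \<open>Both the vector space of signature (2,1) and the affine space modelled on it
  are represented by \<^typ>\<open>real^3\<close>.\<close>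

definition mink :: "real^3 \<Rightarrow> real^3 \<Rightarrow> real" where
  "mink x y = x $ 1 * y $ 1 + x $ 2 * y $ 2 - x $ 3 * y $ 3"

definition timelike :: "real^3 \<Rightarrow> bool" where
  "timelike x \<longleftrightarrow> mink x x < 0"

definition lightlike :: "real^3 \<Rightarrow> bool" where
  "lightlike x \<longleftrightarrow> mink x x = 0"

definition future_lightlike :: "real^3 \<Rightarrow> bool" where
  "future_lightlike x \<longleftrightarrow> lightlike x \<and> x $ 3 > 0"

definition perp :: "real^3 \<Rightarrow> (real^3) set" where
  "perp v = {x. mink x v = 0}"

definition O21 :: "(real^3^3) set" where
  "O21 = {g. \<forall>x y. mink (g *v x) (g *v y) = mink x y}"

definition SO21_0 :: "(real^3^3) set" where
  "SO21_0 = connected_component_set O21 (mat 1)"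

text \<open>A ray is represented by its unique vector of Euclidean length one, so the space of
  future-pointing lightlike rays is a round circle in \<^typ>\<open>real^3\<close> with the subspace topology,
  on which matrices act by applying them and renormalizing.\<close>

definition ray :: "real^3 \<Rightarrow> real^3" where
  "ray x = x /\<^sub>R norm x"

definition future_rays :: "(real^3) set" where
  "future_rays = {x. future_lightlike x \<and> norm x = 1}"

abbreviation rays_topology :: "(real^3) topology" where
  "rays_topology \<equiv> top_of_set future_rays"

definition ray_action :: "real^3^3 \<Rightarrow> real^3 \<Rightarrow> real^3" where
  "ray_action g x = ray (g *v x)"

definition det3 :: "real^3 \<Rightarrow> real^3 \<Rightarrow> real^3 \<Rightarrow> real" where
  "det3 x y z = det (transpose (vector [x, y, z] :: real^3^3))"

definition positive_triple :: "real^3 \<Rightarrow> real^3 \<Rightarrow> real^3 \<Rightarrow> bool" where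
  "positive_triple x y z \<longleftrightarrow> det3 x y z > 0"

text \<open>The following four are meaningful for hyperbolic elements only: those elements of
  \<^const>\<open>SO21_0\<close> with three distinct real eigenvalues, which then have the form
  \<open>l\<close>, \<open>1\<close>, \<open>1/l\<close> with \<open>0 < l < 1\<close>.\<close>

definition eigval :: "real^3^3 \<Rightarrow> real" where
  "eigval g = (THE l. 0 < l \<and> l < 1 \<and> (\<exists>x. x \<noteq> 0 \<and> g *v x = l *\<^sub>R x))"

definition x_minus :: "real^3^3 \<Rightarrow> real^3" where
  "x_minus g = (THE x. future_lightlike x \<and> norm x = 1 \<and> g *v x = eigval g *\<^sub>R x)"

definition x_plus :: "real^3^3 \<Rightarrow> real^3" where
  "x_plus g = (THE x. future_lightlike x \<and> norm x = 1 \<and> g *v x = inverse (eigval g) *\<^sub>R x)"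

definition x_zero :: "real^3^3 \<Rightarrow> real^3" where
  "x_zero g = (THE x. g *v x = x \<and> mink x x = 1 \<and> det3 x (x_minus g) (x_plus g) > 0)"

definition conical_interval :: "(real^3) set \<Rightarrow> bool" where
  "conical_interval I \<longleftrightarrow> I \<subseteq> future_rays \<and> connected I"

definition closed_conical_interval :: "(real^3) set \<Rightarrow> bool" where
  "closed_conical_interval I \<longleftrightarrow> conical_interval I \<and> closedin rays_topology I"

text \<open>Signs are booleans throughout: \<^const>\<open>True\<close> is plus, \<^const>\<open>False\<close> is minus.\<close>

definition schottky_system ::
    "('i::finite \<Rightarrow> real^3^3) \<Rightarrow> ('i \<Rightarrow> bool \<Rightarrow> (real^3) set) \<Rightarrow> bool" where
  "schottky_system gs A \<longleftrightarrow>
     (\<forall>i s. closed_conical_interval (A i s)) \<and>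
     disjoint_family (\<lambda>(i, s). A i s) \<and>
     (\<forall>i. ray_action (gs i) ` A i False = rays_topology closure_of (future_rays - A i True))"

definition transversal :: "real^3^3 \<Rightarrow> real^3^3 \<Rightarrow> bool" where
  "transversal g h \<longleftrightarrow>
     (\<exists>u. timelike u \<and> perp (x_zero g) \<inter> perp (x_zero h) = span {u})"

text \<open>The letter \<open>(i, s)\<close> stands for the \<open>i\<close>-th generator raised to the power plus or
  minus one, according to \<open>s\<close>.\<close>

type_synonym 'i word = "('i \<times> bool) list"

definition reduced :: "'i word \<Rightarrow> bool" where
  "reduced w \<longleftrightarrow> successively (\<lambda>(i, s) (j, t). \<not> (i = j \<and> s \<noteq> t)) w"

definition cyclically_reduced :: "'i word \<Rightarrow> bool" where
  "cyclically_reduced w \<longleftrightarrow> reduced w \<and> reduced (w @ w)"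

definition linear_word :: "('i \<Rightarrow> real^3^3) \<Rightarrow> 'i word \<Rightarrow> real^3^3" where
  "linear_word gs w =
     foldr (\<lambda>(i, s) M. (if s then gs i else matrix_inv (gs i)) ** M) w (mat 1)"

definition affine_word :: "('i \<Rightarrow> real^3 \<Rightarrow> real^3) \<Rightarrow> 'i word \<Rightarrow> real^3 \<Rightarrow> real^3" where
  "affine_word gs w =
     foldr (\<lambda>(i, s) f. (if s then gs i else inv (gs i)) \<circ> f) w id"

datatype gen = Gen_g | Gen_h

instance gen :: finite
proof
  have "(UNIV :: gen set) = {Gen_g, Gen_h}"
    using gen.exhaust by auto
  then show "finite (UNIV :: gen set)"
    by (metis finite.emptyI finite.insertI)
qed

definition W_set :: "bool \<Rightarrow> gen word set" where
  "W_set s = {v. cyclically_reduced v \<and>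
     (\<exists>i\<ge>1. \<exists>w. v = [(Gen_g, True)] @ replicate i (Gen_h, s) @ [(Gen_g, False)] @ w)}"

text \<open>A Schottky system for \<open>g\<close>, \<open>h\<close> determines the interval \<open>I\<close> below: of the two arcs of
  the circle with the given endpoints, exactly one lies in \<open>A Gen_g True\<close>.\<close>

definition property_C ::
    "real^3^3 \<Rightarrow> real^3^3 \<Rightarrow> (gen \<Rightarrow> bool \<Rightarrow> (real^3) set) \<Rightarrow> bool" where
  "property_C g h A \<longleftrightarrow>
     (\<exists>I. closed_conical_interval I \<and> I \<subseteq> A Gen_g True \<and>
          rays_topology frontier_of I = {x_plus (g ** h), ray_action g (x_plus h)} \<and>
          (\<forall>x. future_lightlike x \<and> ray x \<in> I \<longrightarrow>
            (\<forall>w1 \<in> W_set True. \<forall>w2 \<in> W_set False.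
               - mink x (x_zero (linear_word (case_gen g h) w1))
                 < mink x (x_zero (linear_word (case_gen g h) w2)))))"

definition affine_map :: "real^3^3 \<Rightarrow> real^3 \<Rightarrow> real^3 \<Rightarrow> real^3" where
  "affine_map g v x = g *v x + v"

definition affine_group :: "('i \<Rightarrow> real^3 \<Rightarrow> real^3) \<Rightarrow> (real^3 \<Rightarrow> real^3) set" where
  "affine_group gs = range (affine_word gs)"

definition word_length :: "('i \<Rightarrow> real^3 \<Rightarrow> real^3) \<Rightarrow> (real^3 \<Rightarrow> real^3) \<Rightarrow> nat" where
  "word_length gs f = (LEAST k. \<exists>w. length w = k \<and> affine_word gs w = f)"

definition linear_part :: "(real^3 \<Rightarrow> real^3) \<Rightarrow> real^3^3" where
  "linear_part f = matrix (\<lambda>x. f x - f 0)"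

text \<open>The base point of the Margulis invariant is immaterial (see \<open>margulis_base_point\<close>);
  the origin is used.\<close>

definition margulis :: "(real^3 \<Rightarrow> real^3) \<Rightarrow> real" where
  "margulis f = mink (f 0 - 0) (x_zero (linear_part f))"

definition acts_properly :: "(real^3 \<Rightarrow> real^3) set \<Rightarrow> bool" where
  "acts_properly \<Gamma> \<longleftrightarrow> (\<forall>K. compact K \<longrightarrow> finite {f \<in> \<Gamma>. f ` K \<inter> K \<noteq> {}})"

lemma linear_part_affine_map: "linear_part (affine_map g v) = g"
  by (simp add: linear_part_def affine_map_def)

lemma margulis_base_point:
  assumes "g \<in> O21" and "g *v x_zero g = x_zero g"
  shows "mink (affine_map g v p - p) (x_zero g) = margulis (affine_map g v)"
proof -
  have "mink (g *v p) (x_zero g) = mink p (x_zero g)"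
    using assms unfolding O21_def by (metis (mono_tags, lifting) mem_Collect_eq)
  then show ?thesis
    unfolding margulis_def linear_part_affine_map
    by (simp add: mink_def affine_map_def algebra_simps)
qed

end

theory Submission
  imports Defs
begin

text \<open>
  If an affine deformation gives a hyperbolic element Margulis invariant zero, that element fixes a
  point and all of its powers do, so the deformation is not proper. It therefore suffices to find a
  deformation with invariant zero on some long word and positive invariant on all short ones.

  Start from \<open>v\<^sub>g = q\<close>, the lightlike vector on the ray \<open>g(x\<^sub>h\<^sup>+)\<close>, and \<open>v\<^sub>h = 0\<close>. The invariant
  of a cyclically reduced word is then a sum over its letters \<open>g\<^sup>\<plusminus>\<^sup>1\<close> of terms \<open>B(q, x\<^sup>0\<^sub>w)\<close>, one for
  each \<open>w\<close> starting with \<open>g\<close> that is a rotation of the word or of its inverse. The sign of such a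
  term is the cyclic order of \<open>q\<close> and the two fixed rays of \<open>w\<close>. It can be negative only when \<open>w\<close>
  starts with \<open>g h\<^sup>i g\<^sup>-\<^sup>1\<close>; these terms come in pairs, one with \<open>i > 0\<close> and one with \<open>i < 0\<close>,
  whose sum is positive by Property C. So the invariant is positive on every word involving \<open>g\<close>,
  but it tends to zero along \<open>g h\<^sup>i\<close>. A small change of \<open>v\<^sub>g\<close> makes it vanish on \<open>g h\<^sup>i\<close>
  for a large \<open>i\<close>, and a small multiple of \<open>x\<^sup>0\<^sub>h\<close> as \<open>v\<^sub>h\<close> makes it positive on the powers of \<open>h\<close>,
  while it stays positive on the finitely many other short words.
\<close>

subsection \<open>The Lorentzian form\<close>

lemma mink_commute: "mink x y = mink y x"
  by (simp add: mink_def)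

lemma mink_simps [simp]:
  "mink (x + y) z = mink x z + mink y z" "mink z (x + y) = mink z x + mink z y"
  "mink (x - y) z = mink x z - mink y z" "mink z (x - y) = mink z x - mink z y"
  "mink (c *\<^sub>R x) z = c * mink x z" "mink z (c *\<^sub>R x) = c * mink z x"
  "mink (- x) z = - mink x z" "mink z (- x) = - mink z x"
  "mink 0 z = 0" "mink z 0 = 0"
  by (simp_all add: mink_def algebra_simps)

lemma mink_sum_left: "mink (sum f I) z = (\<Sum>i\<in>I. mink (f i) z)"
  by (induction I rule: infinite_finite_induct) auto

lemma continuous_on_mink [continuous_intros]:
  "continuous_on S f \<Longrightarrow> continuous_on S k \<Longrightarrow> continuous_on S (\<lambda>x. mink (f x) (k x))"
  unfolding mink_def by (intro continuous_intros)

lemma mink_nondegenerate: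
  assumes "\<And>x. mink x y = mink x z"
  shows "y = z"
proof -
  have "y $ i = z $ i" for i
    using assms[of "axis i 1"] exhaust_3[of i] by (auto simp: mink_def axis_def)
  then show ?thesis by (simp add: vec_eq_iff)
qed

lemma det3_expand:
  "det3 x y z = x$1 * (y$2 * z$3 - y$3 * z$2) - x$2 * (y$1 * z$3 - y$3 * z$1)
     + x$3 * (y$1 * z$2 - y$2 * z$1)"
  by (simp add: det3_def det_3 transpose_def algebra_simps)

lemma det3_scale:
  "det3 (c *\<^sub>R x) y z = c * det3 x y z" "det3 x (c *\<^sub>R y) z = c * det3 x y z"
  "det3 x y (c *\<^sub>R z) = c * det3 x y z"
  by (simp_all add: det3_expand algebra_simps)

lemma det3_cyclic: "det3 y z x = det3 x y z"
  by (simp add: det3_expand algebra_simps)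

lemma det3_swap: "det3 x z y = - det3 x y z"
  by (simp add: det3_expand algebra_simps)

lemma det3_same [simp]: "det3 x x y = 0" "det3 x y x = 0" "det3 y x x = 0"
  by (simp_all add: det3_expand algebra_simps)

lemma det3_mult: "det3 (M *v x) (M *v y) (M *v z) = det M * det3 x y z"
proof -
  have "transpose (vector [M *v x, M *v y, M *v z] :: real^3^3)
      = M ** transpose (vector [x, y, z])"
    by (simp add: vec_eq_iff forall_3 transpose_def matrix_matrix_mult_def
        matrix_vector_mult_def)
  then show ?thesis by (simp add: det3_def det_mul)
qed

lemma continuous_on_det3 [continuous_intros]:
  "continuous_on S f \<Longrightarrow> continuous_on S k \<Longrightarrow> continuous_on S l
    \<Longrightarrow> continuous_on S (\<lambda>x. det3 (f x) (k x) (l x))"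
  unfolding det3_expand by (intro continuous_intros)

text \<open>The square of the determinant is minus the Gram determinant of \<open>mink\<close>; for
  lightlike vectors the Gram matrix has zero diagonal, so only the product of the off-diagonal
  entries survives.\<close>

lemma det3_square_lightlike:
  assumes "lightlike x" "lightlike y" "lightlike z"
  shows "(det3 x y z)\<^sup>2 = - 2 * mink x y * mink y z * mink z x"
  using assms unfolding lightlike_def mink_def det3_expand by algebra

text \<open>The Euclidean cross product with its third coordinate negated, which makes it dual to
  \<open>det3\<close> under \<open>mink\<close> instead of the dot product.\<close>

definition mink_cross :: "real^3 \<Rightarrow> real^3 \<Rightarrow> real^3" where
  "mink_cross a b = vector [a$2 * b$3 - a$3 * b$2, a$3 * b$1 - a$1 * b$3,
     a$2 * b$1 - a$1 * b$2]"

lemma mink_cross: "mink v (mink_cross a b) = det3 v a b"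
  by (simp add: mink_def mink_cross_def det3_expand algebra_simps)

lemma mink_cross_square:
  "mink (mink_cross a b) (mink_cross a b) = (mink a b)\<^sup>2 - mink a a * mink b b"
  by (simp add: mink_def mink_cross_def power2_eq_square algebra_simps)

lemma mink_cross_scale:
  "mink_cross (c *\<^sub>R a) b = c *\<^sub>R mink_cross a b" "mink_cross a (c *\<^sub>R b) = c *\<^sub>R mink_cross a b"
  by (simp_all add: mink_cross_def vec_eq_iff forall_3 algebra_simps)

subsection \<open>The circle of rays\<close>

lemma norm_square_3: "(norm (x :: real^3))\<^sup>2 = (x$1)\<^sup>2 + (x$2)\<^sup>2 + (x$3)\<^sup>2"
  unfolding power2_norm_eq_inner by (simp add: inner_vec_def sum_3 power2_eq_square)

lemma future_rays_iff: "x \<in> future_rays \<longleftrightarrow> (x$1)\<^sup>2 + (x$2)\<^sup>2 = 1/2 \<and> x$3 = sqrt (1/2)"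
proof -
  have s: "x$3 = sqrt (1/2) \<longleftrightarrow> x$3 > 0 \<and> (x$3)\<^sup>2 = 1/2"
    by (smt (verit, best) divide_pos_pos real_sqrt_gt_0_iff real_sqrt_pow2 real_sqrt_unique)
  have "norm x = 1 \<longleftrightarrow> (norm x)\<^sup>2 = 1"
    by (simp add: abs_square_eq_1)
  then show ?thesis
    unfolding future_rays_def future_lightlike_def lightlike_def mem_Collect_eq s norm_square_3 mink_def
    by (auto simp: power2_eq_square)
qed

lemma future_raysD:
  assumes "x \<in> future_rays"
  shows "future_lightlike x" "lightlike x" "mink x x = 0" "norm x = 1" "x \<noteq> 0"
  using assms by (auto simp: future_rays_def future_lightlike_def lightlike_def)

text \<open>All rays sit at the same height, so \<open>x - y\<close> is horizontal and
  \<open>mink\<close> is Euclidean on it. Thus \<open>mink\<close> measures chord length, which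
  gives its sign and a bound on the whole circle.\<close>

lemma mink_future_rays:
  assumes "x \<in> future_rays" "y \<in> future_rays"
  shows "mink x y = - (norm (x - y))\<^sup>2 / 2"
proof -
  have 3: "x$3 = y$3"
    using assms by (simp add: future_rays_iff)
  have "(norm (x - y))\<^sup>2 = (x$1 - y$1)\<^sup>2 + (x$2 - y$2)\<^sup>2 + (x$3 - y$3)\<^sup>2"
    by (simp add: norm_square_3)
  also have "\<dots> = mink (x - y) (x - y)"
    by (simp add: 3 mink_def power2_eq_square del: mink_simps)
  also have "\<dots> = - 2 * mink x y"
    using assms by (simp add: future_raysD mink_commute)
  finally show ?thesis by simp
qed

lemma mink_future_rays_neg:
  assumes "x \<in> future_rays" "y \<in> future_rays" "x \<noteq> y"
  shows "mink x y < 0"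
  using assms by (simp add: mink_future_rays)

lemma mink_future_rays_bound:
  assumes "x \<in> future_rays" "y \<in> future_rays"
  shows "\<bar>mink x y\<bar> \<le> 2"
proof -
  have "norm (x - y) \<le> 2"
    using norm_triangle_ineq4[of x y] assms by (simp add: future_raysD)
  then have "(norm (x - y))\<^sup>2 \<le> 2\<^sup>2"
    by (rule power_mono) simp
  then show ?thesis
    using assms by (simp add: mink_future_rays)
qed

lemma det3_future_rays_nonzero:
  assumes "x \<in> future_rays" "y \<in> future_rays" "z \<in> future_rays" "x \<noteq> y" "y \<noteq> z" "z \<noteq> x"
  shows "det3 x y z \<noteq> 0"
proof -
  have "(det3 x y z)\<^sup>2 \<noteq> 0"
    using assms by (subst det3_square_lightlike) (auto simp: future_raysD mink_future_rays)
  then show ?thesis by simp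
qed

lemma ray_in_future_rays:
  assumes "future_lightlike x"
  shows "ray x \<in> future_rays" "norm x > 0" "x = norm x *\<^sub>R ray x"
proof -
  show n: "norm x > 0"
    using assms by (auto simp: future_lightlike_def)
  then show "x = norm x *\<^sub>R ray x"
    by (simp add: ray_def)
  show "ray x \<in> future_rays"
    using assms n by (simp add: ray_def future_rays_def future_lightlike_def lightlike_def)
qed

lemma ray_scale: "c > 0 \<Longrightarrow> ray (c *\<^sub>R x) = ray x"
  by (simp add: ray_def)

lemma ray_future_ray: "x \<in> future_rays \<Longrightarrow> ray x = x"
  by (simp add: ray_def future_raysD)

lemma compact_future_rays: "compact future_rays"
proof -
  have "closed {x :: real^3. (x$1)\<^sup>2 + (x$2)\<^sup>2 = 1/2 \<and> x$3 = sqrt (1/2)}"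
    by (intro closed_Collect_conj closed_Collect_eq continuous_intros)
  then have "closed future_rays"
    by (simp only: future_rays_iff[symmetric] Collect_mem_eq)
  moreover have "bounded future_rays"
    by (rule boundedI[of _ 1]) (simp add: future_raysD)
  ultimately show ?thesis
    by (simp add: compact_eq_bounded_closed)
qed

lemma future_rays_nonempty: "future_rays \<noteq> {}"
proof -
  have "(vector [sqrt (1/2), 0, sqrt (1/2)] :: real^3) \<in> future_rays"
    by (simp add: future_rays_iff)
  then show ?thesis by blast
qed

text \<open>Up to the sign, this is the stereographic projection from \<open>z\<close>.\<close>

definition stereo :: "real^3 \<Rightarrow> real^3 \<Rightarrow> real" where
  "stereo z y = (z$2 * y$1 - z$1 * y$2) / mink z y"

text \<open>Seen from \<open>z\<close>, the cyclic order of the circle becomes the linear order of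
  one real coordinate. This makes transitivity and intermediate value arguments available.\<close>

lemma det3_pos_iff_stereo:
  assumes "z \<in> future_rays" "y \<in> future_rays" "w \<in> future_rays" "y \<noteq> z" "w \<noteq> z"
  shows "det3 z y w > 0 \<longleftrightarrow> stereo z w < stereo z y"
proof -
  have m: "mink z y < 0" "mink z w < 0"
    using assms mink_future_rays_neg by auto
  have z: "z$1 * z$1 + z$2 * z$2 = z$3 * z$3" "z$3 > 0"
    using future_raysD(1)[OF assms(1)]
    by (auto simp: future_lightlike_def lightlike_def mink_def)
  have "z$3 * det3 z y w
      = (z$2 * y$1 - z$1 * y$2) * mink z w - (z$2 * w$1 - z$1 * w$2) * mink z y"
    unfolding det3_expand mink_def using z(1) by algebra
  also have "\<dots> = (stereo z y - stereo z w) * (mink z y * mink z w)"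
    using m by (simp add: stereo_def divide_simps algebra_simps)
  finally have "z$3 * det3 z y w = (stereo z y - stereo z w) * (mink z y * mink z w)" .
  moreover have "mink z y * mink z w > 0"
    using m by (simp add: mult_neg_neg)
  ultimately show ?thesis
    using z(2) by (smt (verit, ccfv_SIG) zero_less_mult_iff)
qed

text \<open>Both claims are transitivity of the order of stereographic coordinates, taken from
  \<open>x\<close> for the first and from \<open>z\<close> for the second.\<close>

lemma cyclic_order_trans:
  assumes "x \<in> future_rays" "y \<in> future_rays" "z \<in> future_rays" "w \<in> future_rays"
    and "det3 x y z > 0" "det3 x z w > 0"
  shows "det3 x y w > 0" "det3 y z w > 0"
proof -
  have ne: "y \<noteq> x" "z \<noteq> x" "w \<noteq> x" "y \<noteq> z" "w \<noteq> z"
    using assms(5,6) by auto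
  show xyw: "det3 x y w > 0"
    using assms ne by (simp add: det3_pos_iff_stereo)
  have "det3 z x y > 0" "det3 z w x > 0"
    using assms(5,6) by (simp_all add: det3_cyclic[of x y z] det3_cyclic[of z w x])
  then have "det3 z w y > 0"
    using assms ne by (simp add: det3_pos_iff_stereo)
  then show "det3 y z w > 0"
    by (simp add: det3_cyclic[of z w y])
qed

subsection \<open>Lorentz transformations\<close>

text \<open>The algebraic properties of the identity component that the proof works with;
  \<open>SO21_0_subset_lorentz\<close> derives them from connectedness.\<close>

definition lorentz :: "(real^3^3) set" where
  "lorentz = {M \<in> O21. det M = 1 \<and> (\<forall>x. future_lightlike x \<longrightarrow> future_lightlike (M *v x))}"

lemma lorentz_mink: "M \<in> lorentz \<Longrightarrow> mink (M *v x) (M *v y) = mink x y"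
  by (simp add: lorentz_def O21_def)

lemma lorentz_det3: "M \<in> lorentz \<Longrightarrow> det3 (M *v x) (M *v y) (M *v z) = det3 x y z"
  by (simp add: lorentz_def det3_mult)

lemma lorentz_future: "M \<in> lorentz \<Longrightarrow> future_lightlike x \<Longrightarrow> future_lightlike (M *v x)"
  by (simp add: lorentz_def)

lemma lorentz_one [simp]: "mat 1 \<in> lorentz"
  by (simp add: lorentz_def O21_def)

lemma lorentz_mult: "M \<in> lorentz \<Longrightarrow> N \<in> lorentz \<Longrightarrow> M ** N \<in> lorentz"
  by (simp add: lorentz_def O21_def det_mul matrix_vector_mul_assoc[symmetric])

lemma lorentz_inv:
  assumes "M \<in> lorentz"
  shows "M ** matrix_inv M = mat 1" "matrix_inv M ** M = mat 1" "matrix_inv M \<in> lorentz"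
proof -
  have d: "det M = 1"
    using assms by (simp add: lorentz_def)
  then have "invertible M"
    by (simp add: invertible_det_nz)
  then have "\<exists>N. M ** N = mat 1 \<and> N ** M = mat 1"
    by (simp add: invertible_def)
  then have "M ** matrix_inv M = mat 1 \<and> matrix_inv M ** M = mat 1"
    unfolding matrix_inv_def by (rule someI_ex)
  then show 1: "M ** matrix_inv M = mat 1" and 2: "matrix_inv M ** M = mat 1"
    by auto
  have v: "M *v (matrix_inv M *v x) = x" for x
    by (simp add: matrix_vector_mul_assoc 1)
  have O: "mink (matrix_inv M *v x) (matrix_inv M *v y) = mink x y" for x y
    using lorentz_mink[OF assms, of "matrix_inv M *v x" "matrix_inv M *v y"] by (simp add: v)
  have "det M * det (matrix_inv M) = 1"
    by (metis 1 det_I det_mul)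
  then have "det (matrix_inv M) = 1"
    by (simp add: d)
  moreover have "future_lightlike (matrix_inv M *v x)" if x: "future_lightlike x" for x
  proof (rule ccontr)
    let ?y = "matrix_inv M *v x"
    assume n: "\<not> future_lightlike ?y"
    have l: "mink ?y ?y = 0"
      using x by (simp add: O future_lightlike_def lightlike_def)
    have "?y $ 3 \<noteq> 0"
    proof
      assume "?y $ 3 = 0"
      with l have "?y $ 1 = 0 \<and> ?y $ 2 = 0"
        by (simp add: mink_def sum_squares_eq_zero_iff)
      with \<open>?y $ 3 = 0\<close> have "?y = 0"
        by (simp add: vec_eq_iff forall_3)
      then have "x = 0" using v[of x] by simp
      then show False using x by (simp add: future_lightlike_def)
    qed
    \<comment> \<open>A non-zero lightlike vector that is not future-pointing has a future-pointing
      negative, whose image under \<open>M\<close> would be \<open>- x\<close>.\<close>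
    then have "future_lightlike (- ?y)"
      using n l by (auto simp: future_lightlike_def lightlike_def)
    then have "future_lightlike (M *v (- ?y))"
      by (rule lorentz_future[OF assms])
    also have "M *v (- ?y) = - x"
      by (simp only: v vec.neg)
    finally show False
      using x by (simp add: future_lightlike_def)
  qed
  ultimately show "matrix_inv M \<in> lorentz"
    using O by (simp add: lorentz_def O21_def)
qed

lemma lorentz_inv_cancel [simp]:
  assumes "M \<in> lorentz"
  shows "M *v (matrix_inv M *v x) = x" "matrix_inv M *v (M *v x) = x"
  using assms by (simp_all add: matrix_vector_mul_assoc lorentz_inv)

lemma lorentz_inv_unique:
  assumes "M \<in> lorentz" "N ** M = mat 1"
  shows "matrix_inv M = N"
  by (metis assms lorentz_inv(1) matrix_mul_assoc matrix_mul_lid matrix_mul_rid)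

lemma lorentz_inv_mult:
  assumes "M \<in> lorentz" "N \<in> lorentz"
  shows "matrix_inv (M ** N) = matrix_inv N ** matrix_inv M"
proof (rule lorentz_inv_unique)
  show "M ** N \<in> lorentz" by (rule lorentz_mult[OF assms])
  show "matrix_inv N ** matrix_inv M ** (M ** N) = mat 1"
    by (metis assms lorentz_inv(2) matrix_mul_assoc matrix_mul_rid)
qed

lemma lorentz_inv_inv: "M \<in> lorentz \<Longrightarrow> matrix_inv (matrix_inv M) = M"
  by (rule lorentz_inv_unique) (simp_all add: lorentz_inv)

lemma lorentz_mink_inv:
  assumes "M \<in> lorentz"
  shows "mink (M *v x) y = mink x (matrix_inv M *v y)"
  using lorentz_mink[OF assms, of x "matrix_inv M *v y"] assms by simp

lemma lorentz_mink_cross: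
  assumes "M \<in> lorentz"
  shows "M *v mink_cross a b = mink_cross (M *v a) (M *v b)"
proof (rule mink_nondegenerate)
  fix x
  have "mink x (M *v mink_cross a b) = mink (matrix_inv M *v x) (mink_cross a b)"
    using lorentz_mink[OF assms, of "matrix_inv M *v x"] assms by simp
  also have "\<dots> = mink x (mink_cross (M *v a) (M *v b))"
    using lorentz_det3[OF assms, of "matrix_inv M *v x" a b] assms by (simp add: mink_cross)
  finally show "mink x (M *v mink_cross a b) = mink x (mink_cross (M *v a) (M *v b))" .
qed

lemma O21_det_squared:
  assumes "M \<in> O21"
  shows "(det M)\<^sup>2 = 1"
proof -
  let ?e = "\<lambda>i. axis i 1 :: real^3"
  \<comment> \<open>Minus the Gram determinant: it is expressed through \<open>mink\<close> alone,
    so a map preserving \<open>mink\<close> preserves the square of \<open>det3\<close>.\<close>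
  have gram: "(det3 x y z)\<^sup>2 = - (mink x x * (mink y y * mink z z - mink y z * mink y z)
      - mink x y * (mink x y * mink z z - mink y z * mink x z)
      + mink x z * (mink x y * mink y z - mink y y * mink x z))" for x y z
    unfolding det3_expand mink_def by algebra
  have "(det M)\<^sup>2 * (det3 (?e 1) (?e 2) (?e 3))\<^sup>2
      = (det3 (M *v ?e 1) (M *v ?e 2) (M *v ?e 3))\<^sup>2"
    by (simp add: det3_mult power_mult_distrib)
  also have "\<dots> = (det3 (?e 1) (?e 2) (?e 3))\<^sup>2"
    using assms unfolding gram O21_def by simp
  finally show ?thesis
    by (simp add: det3_expand axis_def)
qed

lemma O21_entry_nonzero:
  assumes "M \<in> O21"
  shows "M $ 3 $ 3 \<noteq> 0"
proof
  assume 0: "M $ 3 $ 3 = 0"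
  let ?e = "axis 3 1 :: real^3"
  have "mink (M *v ?e) (M *v ?e) = mink ?e ?e"
    using assms by (simp add: O21_def)
  then show False
    using 0 sum_squares_ge_zero[of "M $ 1 $ 3" "M $ 2 $ 3"]
    by (simp add: mink_def matrix_vector_mult_def sum_3 axis_def)
qed

lemma connected_avoids_zero:
  fixes S :: "real set"
  assumes "connected S" "0 \<notin> S" "a \<in> S" "a > 0" "b \<in> S"
  shows "b > 0"
proof (rule ccontr)
  assume "\<not> b > 0"
  then have "0 \<in> S"
    using assms by (intro connectedD_interval[of S b a 0]) auto
  with assms show False by simp
qed

text \<open>The determinant and the lower right entry are continuous and never vanish on
  \<open>O21\<close>, so both stay positive on a connected set containing the identity. The first
  gives determinant one, the second preservation of the future.\<close>

lemma SO21_0_subset_lorentz: "SO21_0 \<subseteq> lorentz"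
proof
  fix M assume "M \<in> SO21_0"
  then obtain T where T: "connected T" "T \<subseteq> O21" "mat 1 \<in> T" "M \<in> T"
    unfolding SO21_0_def connected_component_def by (auto simp: connected_component_def)
  have entry: "continuous_on S (\<lambda>A::real^3^3. A $ i $ j)" for S i j
    by (intro continuous_intros)
  have "connected (det ` T)"
    by (intro connected_continuous_image T) (unfold det_3, intro continuous_intros entry)
  moreover have "0 \<notin> det ` T"
    using T(2) O21_det_squared by fastforce
  moreover have "1 \<in> det ` T"
    using T(3) by (metis det_I imageI)
  ultimately have "det M > 0"
    using T(4) by (blast intro: connected_avoids_zero[OF _ _ _ zero_less_one])
  then have det: "det M = 1"
    using O21_det_squared[of M] T by (auto simp: power2_eq_1_iff)
  have "connected ((\<lambda>A. A $ 3 $ 3) ` T)"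
    by (intro connected_continuous_image T entry)
  moreover have "0 \<notin> (\<lambda>A. A $ 3 $ 3) ` T"
    using T(2) O21_entry_nonzero by fastforce
  moreover have "1 \<in> (\<lambda>A. A $ 3 $ 3) ` T"
    using T(3) by (force simp: mat_def)
  ultimately have pos: "M $ 3 $ 3 > 0"
    using T(4) by (blast intro: connected_avoids_zero[OF _ _ _ zero_less_one])
  have O: "mink (M *v x) (M *v y) = mink x y" for x y
    using T by (auto simp: O21_def)
  have "future_lightlike (M *v x)" if x: "future_lightlike x" for x
  proof -
    let ?e = "axis 3 1 :: real^3"
    define u where "u = M *v ?e"
    define v where "v = M *v x"
    have u3: "u$3 > 0"
      using pos by (simp add: u_def matrix_vector_mult_def sum_3 axis_def)
    have "mink u u = -1" "mink v v = 0" "mink u v = - (x$3)"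
      using x by (simp_all add: u_def v_def O future_lightlike_def lightlike_def)
        (simp_all add: mink_def axis_def)
    then have *: "u$1 * u$1 + u$2 * u$2 < u$3 * u$3" "v$1 * v$1 + v$2 * v$2 = v$3 * v$3"
        "u$1 * v$1 + u$2 * v$2 < u$3 * v$3"
      using x by (auto simp: mink_def future_lightlike_def)
    \<comment> \<open>If \<open>v$3\<close> were not positive, the strict inequality between the
      products would, after squaring, contradict the Cauchy-Schwarz inequality for the horizontal
      parts of \<open>u\<close> and \<open>v\<close>.\<close>
    have "v$3 > 0"
    proof (rule ccontr)
      assume "\<not> v$3 > 0"
      then have "u$3 * v$3 \<le> 0"
        using u3 by (simp add: mult_nonneg_nonpos)
      then have "(u$3 * v$3)\<^sup>2 < (u$1 * v$1 + u$2 * v$2)\<^sup>2"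
        using *(3) by (intro power2_strict_mono) auto
      also have "\<dots> \<le> (u$1 * u$1 + u$2 * u$2) * (v$1 * v$1 + v$2 * v$2)"
        using zero_le_square[of "u$1 * v$2 - u$2 * v$1"]
        by (simp add: power2_eq_square algebra_simps)
      also have "\<dots> \<le> (u$3 * u$3) * (v$3 * v$3)"
        using * by (intro mult_mono) auto
      finally show False
        by (simp add: power2_eq_square algebra_simps)
    qed
    moreover have "mink v v = 0" by fact
    ultimately show ?thesis
      by (simp add: v_def future_lightlike_def lightlike_def)
  qed
  then show "M \<in> lorentz"
    using det O by (simp add: lorentz_def O21_def)
qed

lemma mat_vec_simps:
  fixes M :: "real^'n^'m"
  shows "M *v (x + y) = M *v x + M *v y" "M *v (x - y) = M *v x - M *v y"
    "M *v (c *\<^sub>R x) = c *\<^sub>R (M *v x)" "M *v (- x) = - (M *v x)" "M *v 0 = 0"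
  by (simp_all add: vec.add vec.diff vec.neg vec.zero matrix_vector_mult_scaleR)

lemma ray_action_mem: "M \<in> lorentz \<Longrightarrow> x \<in> future_rays \<Longrightarrow> ray_action M x \<in> future_rays"
  by (simp add: ray_action_def ray_in_future_rays lorentz_future future_raysD)

lemma ray_action_scale:
  assumes "M \<in> lorentz" "x \<in> future_rays"
  obtains c where "c > 0" "M *v x = c *\<^sub>R ray_action M x"
  using ray_in_future_rays[of "M *v x"] assms
  by (metis future_raysD(1) lorentz_future ray_action_def)

lemma ray_action_one [simp]: "x \<in> future_rays \<Longrightarrow> ray_action (mat 1) x = x"
  by (simp add: ray_action_def ray_future_ray)

lemma ray_action_mult:
  assumes "M \<in> lorentz" "N \<in> lorentz" "x \<in> future_rays"
  shows "ray_action (M ** N) x = ray_action M (ray_action N x)"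
proof -
  obtain c where c: "c > 0" "N *v x = c *\<^sub>R ray_action N x"
    using ray_action_scale assms by blast
  have "ray_action (M ** N) x = ray (M *v (N *v x))"
    by (simp add: ray_action_def matrix_vector_mul_assoc)
  also have "\<dots> = ray_action M (ray_action N x)"
    unfolding c(2) using c(1) by (simp add: mat_vec_simps ray_scale ray_action_def[of M])
  finally show ?thesis .
qed

lemma ray_action_inv [simp]:
  assumes "M \<in> lorentz" "x \<in> future_rays"
  shows "ray_action M (ray_action (matrix_inv M) x) = x"
    "ray_action (matrix_inv M) (ray_action M x) = x"
  using assms by (simp_all add: ray_action_mult[symmetric] lorentz_inv)

lemma ray_action_eigenvector:
  assumes "x \<in> future_rays" "M *v x = c *\<^sub>R x" "c > 0"
  shows "ray_action M x = x"
  using assms by (simp add: ray_action_def ray_scale ray_future_ray)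

lemma det3_ray_action:
  assumes "M \<in> lorentz" "x \<in> future_rays" "y \<in> future_rays" "z \<in> future_rays"
  shows "det3 (ray_action M x) (ray_action M y) (ray_action M z) > 0 \<longleftrightarrow> det3 x y z > 0"
proof -
  obtain a b c where "a > 0" "b > 0" "c > 0" "M *v x = a *\<^sub>R ray_action M x"
      "M *v y = b *\<^sub>R ray_action M y" "M *v z = c *\<^sub>R ray_action M z"
    using ray_action_scale assms by metis
  moreover have "det3 (M *v x) (M *v y) (M *v z) = det3 x y z"
    by (rule lorentz_det3) fact
  ultimately have "det3 x y z = a * b * c * det3 (ray_action M x) (ray_action M y) (ray_action M z)"
    by (simp add: det3_scale ac_simps)
  moreover have "a * b * c > 0"
    using \<open>a > 0\<close> \<open>b > 0\<close> \<open>c > 0\<close> by simp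
  ultimately show ?thesis
    by (metis mult_pos_pos zero_less_mult_pos)
qed

subsection \<open>Hyperbolic transformations\<close>

text \<open>For two distinct rays this is the unit normal of the plane they span, oriented as in the
  definition of \<open>x_zero\<close>. The factor \<open>- mink a b\<close> is the length of
  \<open>mink_cross a b\<close> when both vectors are future-pointing rays.\<close>

definition null_axis :: "real^3 \<Rightarrow> real^3 \<Rightarrow> real^3" where
  "null_axis a b = (1 / - mink a b) *\<^sub>R mink_cross a b"

lemma mink_null_axis: "mink v (null_axis a b) = det3 v a b / - mink a b"
  by (simp add: null_axis_def mink_cross)

lemma null_axis_props:
  assumes "a \<in> future_rays" "b \<in> future_rays" "a \<noteq> b"
  shows "mink a (null_axis a b) = 0" "mink b (null_axis a b) = 0"
    "mink (null_axis a b) (null_axis a b) = 1" "det3 (null_axis a b) a b = - mink a b"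
proof -
  have m: "mink a b < 0"
    by (rule mink_future_rays_neg[OF assms])
  show "mink a (null_axis a b) = 0" "mink b (null_axis a b) = 0"
    by (simp_all add: mink_null_axis)
  show 1: "mink (null_axis a b) (null_axis a b) = 1"
    using m assms by (simp add: null_axis_def mink_cross_square future_raysD power2_eq_square)
  show "det3 (null_axis a b) a b = - mink a b"
    using 1 m by (simp add: mink_null_axis field_simps)
qed

lemma null_axis_scale:
  assumes "c > 0" "d > 0"
  shows "null_axis (c *\<^sub>R a) (d *\<^sub>R b) = null_axis a b"
  using assms by (simp add: null_axis_def mink_cross_scale)

lemma null_axis_swap: "null_axis b a = - null_axis a b"
  by (rule mink_nondegenerate)
    (simp add: mink_null_axis mink_commute[of b a] det3_swap[of _ b a])

lemma lorentz_null_axis: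
  assumes "M \<in> lorentz"
  shows "M *v null_axis a b = null_axis (M *v a) (M *v b)"
  using assms by (simp add: null_axis_def lorentz_mink lorentz_mink_cross mat_vec_simps)

text \<open>The two rays and their axis form a basis with explicit dual coordinates: the remainder
  of the expansion is orthogonal to all three, and their determinant is non-zero.\<close>

lemma null_frame_expand:
  assumes "a \<in> future_rays" "b \<in> future_rays" "a \<noteq> b"
  shows "v = (mink v b / mink a b) *\<^sub>R a + (mink v a / mink a b) *\<^sub>R b
    + mink v (null_axis a b) *\<^sub>R null_axis a b" (is "v = ?w")
proof -
  let ?c = "null_axis a b"
  have m: "mink a b \<noteq> 0" "mink b a \<noteq> 0"
    using mink_future_rays_neg[OF assms] by (simp_all add: mink_commute[of b a])
  define r where "r = v - ?w"
  have r: "mink r a = 0" "mink r b = 0" "mink r ?c = 0"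
    using m null_axis_props[OF assms] assms
    by (simp_all add: r_def future_raysD mink_commute[of ?c a] mink_commute[of ?c b] mink_commute[of b a])
  have "det3 ?c a b * r$1 = 0" "det3 ?c a b * r$2 = 0" "det3 ?c a b * r$3 = 0"
    using r unfolding mink_def det3_expand by algebra+
  then have "r = 0"
    using null_axis_props(4)[OF assms] m by (simp add: vec_eq_iff forall_3)
  then show ?thesis by (simp add: r_def)
qed

text \<open>Explicit eigendata with repelling ray \<open>a\<close>, attracting ray \<open>b\<close>
  and expansion factor \<open>\<mu>\<close>. Once such data are found, the definite descriptions
  \<open>eigval\<close>, \<open>x_minus\<close>, \<open>x_plus\<close> and \<open>x_zero\<close> can
  all be evaluated.\<close>

definition hyp_frame :: "real^3^3 \<Rightarrow> real^3 \<Rightarrow> real^3 \<Rightarrow> real \<Rightarrow> bool" where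
  "hyp_frame M a b \<mu> \<longleftrightarrow> M \<in> lorentz \<and> a \<in> future_rays \<and> b \<in> future_rays \<and> \<mu> > 1
     \<and> M *v a = inverse \<mu> *\<^sub>R a \<and> M *v b = \<mu> *\<^sub>R b"

lemma hyp_frameD:
  assumes "hyp_frame M a b \<mu>"
  shows "M \<in> lorentz" "a \<in> future_rays" "b \<in> future_rays" "\<mu> > 1" "a \<noteq> b"
    "M *v a = inverse \<mu> *\<^sub>R a" "M *v b = \<mu> *\<^sub>R b" "M *v null_axis a b = null_axis a b"
proof -
  show M: "M \<in> lorentz" "a \<in> future_rays" "b \<in> future_rays" "\<mu> > 1"
    "M *v a = inverse \<mu> *\<^sub>R a" "M *v b = \<mu> *\<^sub>R b"
    using assms by (auto simp: hyp_frame_def)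
  show "a \<noteq> b"
  proof
    assume "a = b"
    then have "(\<mu> - inverse \<mu>) *\<^sub>R a = 0"
      using M by (simp add: scaleR_left_diff_distrib)
    moreover have "inverse \<mu> < 1"
      using M(4) by (simp add: inverse_less_1_iff)
    ultimately show False
      using M by (auto simp: future_raysD(5))
  qed
  show "M *v null_axis a b = null_axis a b"
    using M by (simp add: lorentz_null_axis null_axis_scale)
qed

text \<open>Since \<open>M\<close> preserves \<open>mink\<close>, two eigenvectors pair to zero
  unless their eigenvalues multiply to one. An eigenvector for \<open>l < 1\<close> thus pairs
  trivially with \<open>a\<close> and the axis, hence not with \<open>b\<close>, and
  \<open>l * \<mu> = 1\<close>.\<close>

lemma hyp_frame_eigval:
  assumes H: "hyp_frame M a b \<mu>"
  shows "eigval M = inverse \<mu>"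
  unfolding eigval_def
proof (rule the_equality)
  note D = hyp_frameD[OF H]
  show "0 < inverse \<mu> \<and> inverse \<mu> < 1 \<and> (\<exists>x. x \<noteq> 0 \<and> M *v x = inverse \<mu> *\<^sub>R x)"
    using D(2,4,6) by (auto simp: inverse_less_1_iff dest: future_raysD(5))
  fix l :: real
  assume "0 < l \<and> l < 1 \<and> (\<exists>x. x \<noteq> 0 \<and> M *v x = l *\<^sub>R x)"
  then obtain x where l: "0 < l" "l < 1" and x: "x \<noteq> 0" "M *v x = l *\<^sub>R x"
    by blast
  have "mink x a = l * inverse \<mu> * mink x a"
    using lorentz_mink[OF D(1), of x a] unfolding x(2) D(6) mink_simps by (simp only: ac_simps)
  moreover have "l * inverse \<mu> < 1"
    using l D(4) by (simp add: field_simps)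
  ultimately have a: "mink x a = 0" by auto
  have "mink x (null_axis a b) = l * mink x (null_axis a b)"
    using lorentz_mink[OF D(1), of x "null_axis a b"] x D by simp
  then have c: "mink x (null_axis a b) = 0"
    using l by simp
  have "mink x b \<noteq> 0"
  proof
    assume "mink x b = 0"
    with a c have "x = 0"
      using null_frame_expand[OF D(2,3,5), of x] by simp
    with x show False by simp
  qed
  moreover have "mink x b = l * \<mu> * mink x b"
    using lorentz_mink[OF D(1), of x b] unfolding x(2) D(7) mink_simps by (simp only: ac_simps)
  ultimately have "l * \<mu> = 1" by simp
  then show "l = inverse \<mu>"
    using D(4) by (simp add: field_simps)
qed

text \<open>Eigenvectors for the same eigenvalue below one are orthogonal, and orthogonal
  future-pointing rays coincide.\<close>

lemma hyp_frame_x_minus: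
  assumes H: "hyp_frame M a b \<mu>"
  shows "x_minus M = a"
  unfolding x_minus_def hyp_frame_eigval[OF H]
proof (rule the_equality)
  note D = hyp_frameD[OF H]
  show "future_lightlike a \<and> norm a = 1 \<and> M *v a = inverse \<mu> *\<^sub>R a"
    using D by (simp add: future_raysD)
  fix x
  assume x: "future_lightlike x \<and> norm x = 1 \<and> M *v x = inverse \<mu> *\<^sub>R x"
  have "mink x a = inverse \<mu> * inverse \<mu> * mink x a"
    using lorentz_mink[OF D(1), of x a] x D by simp
  moreover have "inverse \<mu> * inverse \<mu> < 1"
    using less_1_mult[OF D(4) D(4)] D(4) by (simp add: field_simps)
  ultimately have "mink x a = 0" by auto
  then show "x = a"
    using mink_future_rays_neg[of x a] x D(2) by (force simp: future_rays_def)
qed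

lemma hyp_frame_x_plus:
  assumes H: "hyp_frame M a b \<mu>"
  shows "x_plus M = b"
  unfolding x_plus_def hyp_frame_eigval[OF H]
proof (rule the_equality)
  note D = hyp_frameD[OF H]
  show "future_lightlike b \<and> norm b = 1 \<and> M *v b = inverse (inverse \<mu>) *\<^sub>R b"
    using D by (simp add: future_raysD)
  fix x
  assume x: "future_lightlike x \<and> norm x = 1 \<and> M *v x = inverse (inverse \<mu>) *\<^sub>R x"
  have "mink x b = \<mu> * \<mu> * mink x b"
    using lorentz_mink[OF D(1), of x b] x D by simp
  moreover have "\<mu> * \<mu> > 1"
    using D(4) by (rule less_1_mult) (rule D(4))
  ultimately have "mink x b = 0" by auto
  then show "x = b"
    using mink_future_rays_neg[of x b] x D(3) by (force simp: future_rays_def)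
qed

text \<open>A fixed vector is orthogonal to \<open>a\<close> and \<open>b\<close>, hence a multiple
  of their axis; the norm and the orientation leave only the factor one.\<close>

lemma hyp_frame_x_zero:
  assumes H: "hyp_frame M a b \<mu>"
  shows "x_zero M = null_axis a b"
  unfolding x_zero_def hyp_frame_x_minus[OF H] hyp_frame_x_plus[OF H]
proof (rule the_equality)
  note D = hyp_frameD[OF H] and P = null_axis_props[OF hyp_frameD(2,3,5)[OF H]]
  have m: "mink a b < 0"
    by (rule mink_future_rays_neg[OF D(2,3,5)])
  then show "M *v null_axis a b = null_axis a b \<and> mink (null_axis a b) (null_axis a b) = 1
      \<and> det3 (null_axis a b) a b > 0"
    using D P by simp
  fix x
  assume x: "M *v x = x \<and> mink x x = 1 \<and> det3 x a b > 0"
  have "mink x a = inverse \<mu> * mink x a" "mink x b = \<mu> * mink x b"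
    using lorentz_mink[OF D(1), of x a] lorentz_mink[OF D(1), of x b] x D by simp_all
  moreover have "inverse \<mu> < 1"
    using D(4) by (simp add: inverse_less_1_iff)
  ultimately have "mink x a = 0" "mink x b = 0"
    using D(4) by auto
  then obtain t where t: "x = t *\<^sub>R null_axis a b"
    using null_frame_expand[OF D(2,3,5), of x] by auto
  then have "t\<^sup>2 = 1" "t > 0"
    using x P m by (auto simp: power2_eq_square det3_scale zero_less_mult_iff mult_less_0_iff)
  then show "x = null_axis a b"
    using t by (simp add: power2_eq_1_iff)
qed

lemma hyp_frame_conj:
  assumes H: "hyp_frame M a b \<mu>" and P: "P \<in> lorentz"
  shows "hyp_frame (P ** M ** matrix_inv P) (ray_action P a) (ray_action P b) \<mu>"
proof -
  note D = hyp_frameD[OF H]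
  have "(P ** M ** matrix_inv P) *v ray_action P x = c *\<^sub>R ray_action P x"
    if "M *v x = c *\<^sub>R x" for x c
    using that P unfolding ray_action_def ray_def
    by (simp add: matrix_vector_mul_assoc[symmetric] mat_vec_simps)
  then show ?thesis
    using D P by (simp add: hyp_frame_def ray_action_mem lorentz_mult lorentz_inv)
qed

definition hyperbolic :: "real^3^3 \<Rightarrow> bool" where
  "hyperbolic M \<longleftrightarrow> (\<exists>a b \<mu>. hyp_frame M a b \<mu>)"

lemma hyperbolic_conj: "hyperbolic M \<Longrightarrow> P \<in> lorentz \<Longrightarrow> hyperbolic (P ** M ** matrix_inv P)"
  unfolding hyperbolic_def using hyp_frame_conj by blast

lemma x_zero_fixed: "hyperbolic M \<Longrightarrow> M *v x_zero M = x_zero M"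
  unfolding hyperbolic_def by (elim exE) (simp only: hyp_frame_x_zero hyp_frameD(8))

lemma x_zero_norm: "hyperbolic M \<Longrightarrow> mink (x_zero M) (x_zero M) = 1"
  unfolding hyperbolic_def
  by (elim exE) (simp only: hyp_frame_x_zero null_axis_props(3) hyp_frameD(2,3,5) not_False_eq_True)

lemma x_zero_conj:
  assumes "hyperbolic M" and P: "P \<in> lorentz"
  shows "x_zero (P ** M ** matrix_inv P) = P *v x_zero M"
proof -
  obtain a b \<mu> where H: "hyp_frame M a b \<mu>"
    using assms by (auto simp: hyperbolic_def)
  obtain c d where "c > 0" "d > 0" "P *v a = c *\<^sub>R ray_action P a" "P *v b = d *\<^sub>R ray_action P b"
    using ray_action_scale P hyp_frameD(2,3)[OF H] by metis
  then show ?thesis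
    using hyp_frame_x_zero[OF H] hyp_frame_x_zero[OF hyp_frame_conj[OF H P]] P
    by (simp add: lorentz_null_axis null_axis_scale)
qed

lemma hyp_frame_inv:
  assumes "hyp_frame M a b \<mu>"
  shows "hyp_frame (matrix_inv M) b a \<mu>"
proof -
  note D = hyp_frameD[OF assms]
  have "matrix_inv M *v x = inverse c *\<^sub>R x" if "M *v x = c *\<^sub>R x" "c \<noteq> 0" for x c
    using that lorentz_inv_cancel(2)[OF D(1), of x] by (metis mat_vec_simps(3) scaleR_scaleR left_inverse scaleR_one)
  from this[OF D(6)] this[OF D(7)] show ?thesis
    using D by (simp add: hyp_frame_def lorentz_inv)
qed

lemma hyperbolic_inv: "hyperbolic M \<Longrightarrow> hyperbolic (matrix_inv M)"
  unfolding hyperbolic_def using hyp_frame_inv by blast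

lemma x_zero_inv:
  assumes "hyperbolic M"
  shows "x_zero (matrix_inv M) = - x_zero M"
proof -
  obtain a b \<mu> where H: "hyp_frame M a b \<mu>"
    using assms by (auto simp: hyperbolic_def)
  then show ?thesis
    unfolding hyp_frame_x_zero[OF H] hyp_frame_x_zero[OF hyp_frame_inv[OF H]]
    by (intro null_axis_swap)
qed

subsection \<open>Affine maps and the Margulis invariant\<close>

lemma affine_map_comp: "affine_map M v \<circ> affine_map N w = affine_map (M ** N) (M *v w + v)"
  by (simp add: fun_eq_iff affine_map_def matrix_vector_mul_assoc mat_vec_simps)

lemma affine_map_id: "affine_map (mat 1) 0 = id"
  by (simp add: fun_eq_iff affine_map_def)

lemma affine_map_inverse:
  assumes "M \<in> lorentz"
  shows "inv (affine_map M v) = affine_map (matrix_inv M) (- (matrix_inv M *v v))"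
    "bij (affine_map M v)"
proof -
  have *: "affine_map M v \<circ> affine_map (matrix_inv M) (- (matrix_inv M *v v)) = id"
    "affine_map (matrix_inv M) (- (matrix_inv M *v v)) \<circ> affine_map M v = id"
    using assms by (simp_all add: affine_map_comp lorentz_inv mat_vec_simps affine_map_id)
  show "inv (affine_map M v) = affine_map (matrix_inv M) (- (matrix_inv M *v v))"
    by (rule inv_unique_comp[OF *])
  show "bij (affine_map M v)"
    using * o_bij by blast
qed

lemma margulis_affine_map: "margulis (affine_map M v) = mink v (x_zero M)"
  by (simp add: margulis_def linear_part_affine_map) (simp add: affine_map_def)

lemma margulis_conj:
  assumes "hyperbolic M" and P: "P \<in> lorentz"
  shows "margulis (affine_map P p \<circ> affine_map M v \<circ> inv (affine_map P p))
    = margulis (affine_map M v)"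
proof -
  let ?N = "P ** M ** matrix_inv P"
  have N: "?N *v x_zero ?N = x_zero ?N" "?N \<in> lorentz"
    using x_zero_fixed[OF hyperbolic_conj[OF assms]] hyperbolic_conj[OF assms]
    by (auto simp: hyperbolic_def hyp_frame_def)
  \<comment> \<open>The conjugate has linear part \<open>?N\<close> and translation
    \<open>P *v v + p - ?N *v p\<close>; the last two terms cancel when paired with a vector fixed
    by \<open>?N\<close>.\<close>
  have "mink (?N *v p) (x_zero ?N) = mink p (x_zero ?N)"
    using lorentz_mink[OF N(2), of p "x_zero ?N"] by (simp add: N)
  moreover have "mink (P *v v) (x_zero ?N) = mink v (x_zero M)"
    using assms by (simp add: x_zero_conj lorentz_mink)
  ultimately show ?thesis
    using P by (simp add: affine_map_inverse affine_map_comp margulis_affine_map mat_vec_simps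
      matrix_vector_mul_assoc matrix_mul_assoc)
qed

text \<open>Invariant zero places \<open>v\<close> in the span of \<open>a\<close> and
  \<open>b\<close>, where the eigenvalues of \<open>M\<close> differ from one, so the fixed point
  equation is solved coordinate by coordinate.\<close>

lemma fixed_point_of_margulis_zero:
  assumes "hyp_frame M a b \<mu>" "margulis (affine_map M v) = 0"
  obtains p where "affine_map M v p = p"
proof -
  note D = hyp_frameD[OF assms(1)]
  have "mink v (null_axis a b) = 0"
    using assms(2) by (simp add: margulis_affine_map hyp_frame_x_zero[OF assms(1)])
  then obtain s t where v: "v = s *\<^sub>R a + t *\<^sub>R b"
    using null_frame_expand[OF D(2,3,5), of v] by auto
  let ?p = "(s / (1 - inverse \<mu>)) *\<^sub>R a + (t / (1 - \<mu>)) *\<^sub>R b"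
  have *: "r / (1 - c) * c + r = r / (1 - c)" if "c \<noteq> 1" for r c :: real
    using that by (simp add: field_simps)
  have i: "inverse \<mu> \<noteq> 1" "\<mu> \<noteq> 1"
    using D(4) by auto
  have "affine_map M v ?p = (s / (1 - inverse \<mu>) * inverse \<mu> + s) *\<^sub>R a
      + (t / (1 - \<mu>) * \<mu> + t) *\<^sub>R b"
    by (simp add: affine_map_def v mat_vec_simps D scaleR_left_distrib)
  also have "\<dots> = ?p"
    by (simp only: *[OF i(1)] *[OF i(2)])
  finally show ?thesis by (rule that)
qed

text \<open>Powers of a hyperbolic affine map with a fixed point \<open>p\<close> all meet the compact set \<open>{p}\<close>.\<close>

lemma not_acts_properly_of_margulis_zero:
  assumes H: "hyp_frame M a b \<mu>" and "margulis (affine_map M v) = 0"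
    and G: "\<And>k. (affine_map M v ^^ k) \<in> \<Gamma>"
  shows "\<not> acts_properly \<Gamma>"
proof
  assume proper: "acts_properly \<Gamma>"
  note D = hyp_frameD[OF H]
  let ?f = "affine_map M v"
  obtain p where p: "?f p = p"
    using fixed_point_of_margulis_zero[OF assms(1,2)] .
  have shift: "?f (p + x) = p + M *v x" for x
    using p by (simp add: affine_map_def mat_vec_simps algebra_simps)
  \<comment> \<open>The expanding vector \<open>b\<close> tells the powers apart, since they move
    \<open>p + b\<close> to different points.\<close>
  have pow: "(?f ^^ k) (p + b) = p + (\<mu> ^ k) *\<^sub>R b" for k
    by (induction k) (simp_all add: shift mat_vec_simps D mult.commute)
  have fix_p: "(?f ^^ k) p = p" for k
    by (induction k) (simp_all add: p)
  have "inj (\<lambda>k. ?f ^^ k)"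
  proof (rule injI)
    fix k l :: nat
    assume "?f ^^ k = ?f ^^ l"
    then have "(?f ^^ k) (p + b) = (?f ^^ l) (p + b)"
      by (simp only:)
    then have "(\<mu> ^ k) *\<^sub>R b = (\<mu> ^ l) *\<^sub>R b"
      unfolding pow by (rule add_left_imp_eq)
    then have "\<mu> ^ k = \<mu> ^ l"
      using future_raysD(5)[OF D(3)] by auto
    then show "k = l"
      using D(4) by simp
  qed
  then have "infinite (range (\<lambda>k. ?f ^^ k))"
    by (rule range_inj_infinite)
  moreover have "range (\<lambda>k. ?f ^^ k) \<subseteq> {f \<in> \<Gamma>. f ` {p} \<inter> {p} \<noteq> {}}"
    using G fix_p by auto
  ultimately have "infinite {f \<in> \<Gamma>. f ` {p} \<inter> {p} \<noteq> {}}"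
    using infinite_super by blast
  moreover have "finite {f \<in> \<Gamma>. f ` {p} \<inter> {p} \<noteq> {}}"
    using proper unfolding acts_properly_def by (elim allE[of _ "{p}"]) simp
  ultimately show False by contradiction
qed

subsection \<open>Words\<close>

definition flip :: "'i \<times> bool \<Rightarrow> 'i \<times> bool" where
  "flip l = (fst l, \<not> snd l)"

lemma flip_simps [simp]: "flip (i, s) = (i, \<not> s)" "flip (flip l) = l" "fst (flip l) = fst l"
    "flip l \<noteq> l" "l \<noteq> flip l" "flip l = flip k \<longleftrightarrow> l = k"
  by (auto simp: flip_def prod_eq_iff)

definition inv_word :: "'i word \<Rightarrow> 'i word" where
  "inv_word w = rev (map flip w)"

lemma inv_word_simps [simp]:
  "inv_word [] = []" "inv_word (l # w) = inv_word w @ [flip l]"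
  "inv_word (u @ w) = inv_word w @ inv_word u" "inv_word w = [] \<longleftrightarrow> w = []"
  "set (inv_word w) = flip ` set w" "inv_word (replicate k l) = replicate k (flip l)"
  by (simp_all add: inv_word_def)

lemma reduced_iff: "reduced w \<longleftrightarrow> successively (\<lambda>l k. l \<noteq> flip k) w"
  unfolding reduced_def by (intro arg_cong2[of _ _ _ _ successively]) (auto simp: fun_eq_iff)

lemma reduced_inv_word: "reduced (inv_word w) \<longleftrightarrow> reduced w"
  unfolding reduced_iff inv_word_def successively_rev successively_map
  by (intro arg_cong2[of _ _ _ _ successively]) (auto simp: fun_eq_iff)

lemma cyclically_reduced_iff:
  "cyclically_reduced w \<longleftrightarrow> reduced w \<and> (w = [] \<or> last w \<noteq> flip (hd w))"
  by (auto simp: cyclically_reduced_def reduced_iff successively_append_iff)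

lemma cyclically_reduced_rotate:
  assumes "cyclically_reduced (u @ w)"
  shows "cyclically_reduced (w @ u)"
  using assms
  by (cases "u = []"; cases "w = []")
    (auto simp: cyclically_reduced_def reduced_iff successively_append_iff)

lemma cyclically_reduced_inv_word:
  assumes "cyclically_reduced w"
  shows "cyclically_reduced (inv_word w)"
  using assms unfolding cyclically_reduced_def
  by (metis inv_word_simps(3) reduced_inv_word)

lemma hd_last_inv_word:
  "w \<noteq> [] \<Longrightarrow> hd (inv_word w) = flip (last w)" "w \<noteq> [] \<Longrightarrow> last (inv_word w) = flip (hd w)"
  by (simp_all add: inv_word_def hd_rev last_rev last_map hd_map)

lemma reduced_single_generator:
  assumes "reduced w" "\<forall>l \<in> set w. fst l = i"
  obtains s where "w = replicate (length w) (i, s)"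
proof -
  have "\<exists>s. w = replicate (length w) (i, s)"
    using assms
  proof (induction w)
    case (Cons l w)
    then obtain s where s: "w = replicate (length w) (i, s)"
      by (auto simp: reduced_iff successively_Cons)
    show ?case
    proof (cases w)
      case Nil
      then show ?thesis using Cons.prems by (auto simp: prod_eq_iff)
    next
      case (Cons k u)
      then have "k = (i, s)"
        using s by (metis length_Cons list.inject replicate_Suc)
      moreover have "l \<noteq> flip k" "fst l = i"
        using Cons.prems Cons by (auto simp: reduced_iff)
      ultimately have "l = (i, s)"
        by (auto simp: prod_eq_iff flip_def)
      then show ?thesis using s by auto
    qed
  qed simp
  then show ?thesis using that by blast
qed

lemma not_reducedE:
  assumes "\<not> reduced w"
  obtains u l v where "w = u @ [l, flip l] @ v"
proof -
  have "\<exists>u l v. w = u @ [l, flip l] @ v"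
    using assms
  proof (induction w)
    case (Cons l w)
    show ?case
    proof (cases "reduced w")
      case True
      then obtain k v where "w = k # v" "l = flip k"
        using Cons.prems by (cases w) (auto simp: reduced_iff)
      then have "l # w = [] @ [l, flip l] @ v" by simp
      then show ?thesis by blast
    next
      case False
      then obtain u k v where "w = u @ [k, flip k] @ v"
        using Cons.IH by blast
      then have "l # w = (l # u) @ [k, flip k] @ v" by simp
      then show ?thesis by blast
    qed
  qed (simp add: reduced_def)
  then show ?thesis using that by blast
qed

definition letter_matrix :: "('i \<Rightarrow> real^3^3) \<Rightarrow> 'i \<times> bool \<Rightarrow> real^3^3" where
  "letter_matrix M l = (if snd l then M (fst l) else matrix_inv (M (fst l)))"

lemma linear_word_simps [simp]:
  "linear_word M [] = mat 1"
  "linear_word M (l # w) = letter_matrix M l ** linear_word M w"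
  by (simp_all add: linear_word_def letter_matrix_def case_prod_unfold)

lemma linear_word_append: "linear_word M (u @ w) = linear_word M u ** linear_word M w"
  by (induction u) (simp_all add: matrix_mul_assoc)

lemma affine_word_simps [simp]:
  "affine_word F [] = id"
  "affine_word F (l # w) = (if snd l then F (fst l) else inv (F (fst l))) \<circ> affine_word F w"
  by (simp_all add: affine_word_def case_prod_unfold)

lemma affine_word_append: "affine_word F (u @ w) = affine_word F u \<circ> affine_word F w"
  by (induction u) (simp_all add: comp_assoc)

lemma affine_word_bij: "(\<And>i. bij (F i)) \<Longrightarrow> bij (affine_word F w)"
  by (induction w) (simp_all add: bij_comp bij_imp_bij_inv)

lemma affine_word_flip:
  assumes "\<And>i. bij (F i)"
  shows "affine_word F [flip l] = inv (affine_word F [l])"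
  using assms by (simp add: flip_def inv_inv_eq)

text \<open>Induction on the length: an adjacent inverse pair is cancelled, and an inverse pair at
  the two ends is absorbed into the conjugator. The equation is between maps because cancellation
  changes the word.\<close>

lemma cyclic_reduction:
  fixes w :: "'i word"
  assumes F: "\<And>i. bij (F i)"
  obtains p u where "cyclically_reduced u" "length u \<le> length w"
    "affine_word F w = affine_word F p \<circ> affine_word F u \<circ> inv (affine_word F p)"
proof -
  have "\<exists>p u. cyclically_reduced u \<and> length u \<le> length w \<and>
    affine_word F w = affine_word F p \<circ> affine_word F u \<circ> inv (affine_word F p)"
  proof (induction w rule: length_induct)
    case (1 w)
    have b: "bij (affine_word F x)" for x
      using F by (rule affine_word_bij)
    show ?case
    proof (cases "cyclically_reduced w")
      case True
      then show ?thesis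
        by (intro exI[of _ "[]"] exI[of _ w]) simp
    next
      case False
      show ?thesis
      proof (cases "reduced w")
        case False
        then obtain x l y where w: "w = x @ [l, flip l] @ y"
          by (rule not_reducedE)
        have "affine_word F [l, flip l] = affine_word F [l] \<circ> affine_word F [flip l]"
          by (simp add: affine_word_append[symmetric])
        also have "\<dots> = id"
          unfolding affine_word_flip[OF F] by (rule surj_iff[THEN iffD1, OF bij_is_surj[OF b]])
        finally have "affine_word F [l, flip l] = id" .
        then have "affine_word F w = affine_word F (x @ y)"
          by (simp only: w affine_word_append id_comp)
        moreover have len: "length (x @ y) < length w"
          by (simp add: w)
        then obtain p u where "cyclically_reduced u" "length u \<le> length (x @ y)"
          "affine_word F (x @ y) = affine_word F p \<circ> affine_word F u \<circ> inv (affine_word F p)"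
          using 1 by blast
        moreover from this len have "length u \<le> length w"
          by linarith
        ultimately show ?thesis
          by (intro exI[of _ p] exI[of _ u]) simp
      next
        case True
        then have ne: "w \<noteq> []" and hl: "last w = flip (hd w)"
          using \<open>\<not> cyclically_reduced w\<close> by (auto simp: cyclically_reduced_iff)
        obtain l x where lx: "w = l # x"
          using ne by (cases w) auto
        have "x \<noteq> []"
          using hl lx by auto
        then have w: "w = l # butlast x @ [flip l]"
          using hl append_butlast_last_id[of x] unfolding lx by simp
        then have "length (butlast x) < length w"
          by simp
        then obtain p u where pu: "cyclically_reduced u" "length u \<le> length (butlast x)"
          "affine_word F (butlast x) = affine_word F p \<circ> affine_word F u \<circ> inv (affine_word F p)"
          using 1 by blast
        have "w = [l] @ butlast x @ [flip l]"
          using w by simp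
        then have "affine_word F w = affine_word F [l] \<circ> affine_word F (butlast x) \<circ> affine_word F [flip l]"
          by (simp only: affine_word_append comp_assoc)
        also have "\<dots> = affine_word F (l # p) \<circ> affine_word F u \<circ> inv (affine_word F (l # p))"
        proof -
          have "affine_word F (l # p) = affine_word F [l] \<circ> affine_word F p"
            by simp
          then show ?thesis
            by (simp only: pu(3) affine_word_flip[OF F] o_inv_distrib[OF b b] comp_assoc)
        qed
        finally have "affine_word F w
          = affine_word F (l # p) \<circ> affine_word F u \<circ> inv (affine_word F (l # p))" .
        moreover have "length u \<le> length w"
          using pu(2) \<open>length (butlast x) < length w\<close> by simp
        ultimately show ?thesis
          using pu(1) by blast
      qed
    qed
  qed
  then show ?thesis using that by blast
qed

section \<open>Translational parts as a cocycle over words\<close>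

definition letter_translation ::
    "('i \<Rightarrow> real^3^3) \<Rightarrow> ('i \<Rightarrow> real^3) \<Rightarrow> 'i \<times> bool \<Rightarrow> real^3" where
  "letter_translation M v l = (if snd l then v (fst l) else - (matrix_inv (M (fst l)) *v v (fst l)))"

primrec word_translation :: "('i \<Rightarrow> real^3^3) \<Rightarrow> ('i \<Rightarrow> real^3) \<Rightarrow> 'i word \<Rightarrow> real^3" where
  "word_translation M v [] = 0"
| "word_translation M v (l # w) =
     letter_matrix M l *v word_translation M v w + letter_translation M v l"

lemma word_translation_append:
  "word_translation M v (u @ w)
    = linear_word M u *v word_translation M v w + word_translation M v u"
  by (induction u) (simp_all add: matrix_vector_mul_assoc mat_vec_simps)

lemma affine_word_eq:
  assumes "\<And>i. M i \<in> lorentz"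
  shows "affine_word (\<lambda>i. affine_map (M i) (v i)) w
    = affine_map (linear_word M w) (word_translation M v w)"
  using assms
  by (induction w)
    (simp_all add: affine_map_id affine_map_inverse affine_map_comp letter_matrix_def letter_translation_def)

text \<open>Iterating the cocycle identity writes the translation as a sum over the pieces, each
  carried along by the linear part of the preceding pieces.\<close>

lemma word_translation_concat:
  "word_translation M v (concat ws)
    = (\<Sum>j<length ws. linear_word M (concat (take j ws)) *v word_translation M v (ws ! j))"
proof (induction ws)
  case (Cons w ws)
  have "word_translation M v (concat (w # ws)) = linear_word M w *v word_translation M v (concat ws)
      + word_translation M v w"
    by (simp add: word_translation_append)
  also have "linear_word M w *v word_translation M v (concat ws)
      = (\<Sum>j<length ws. linear_word M (concat (take (Suc j) (w # ws))) *v word_translation M v ((w # ws) ! Suc j))"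
    by (simp add: Cons.IH vec.sum linear_word_append matrix_vector_mul_assoc)
  finally show ?case
    unfolding length_Cons sum.lessThan_Suc_shift by simp
qed simp

locale lorentz_family =
  fixes M :: "'i \<Rightarrow> real^3^3"
  assumes M: "M i \<in> lorentz"
begin

lemma letter_matrix_lorentz [simp]: "letter_matrix M l \<in> lorentz"
  by (simp add: letter_matrix_def M lorentz_inv)

lemma linear_word_lorentz [simp]: "linear_word M w \<in> lorentz"
  by (induction w) (simp_all add: lorentz_mult)

lemma letter_matrix_flip: "letter_matrix M (flip l) = matrix_inv (letter_matrix M l)"
  by (simp add: letter_matrix_def M lorentz_inv_inv flip_def)

lemma linear_word_inv: "linear_word M (inv_word w) = matrix_inv (linear_word M w)"
proof (induction w)
  case Nil
  then show ?case
    using lorentz_inv_unique[of "mat 1" "mat 1"] by simp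
next
  case (Cons l w)
  then show ?case
    by (simp add: linear_word_append letter_matrix_flip lorentz_inv_mult)
qed

definition margulis_word :: "('i \<Rightarrow> real^3) \<Rightarrow> 'i word \<Rightarrow> real" where
  "margulis_word v w = mink (word_translation M v w) (x_zero (linear_word M w))"

lemma margulis_affine_word:
  "margulis (affine_word (\<lambda>i. affine_map (M i) (v i)) w) = margulis_word v w"
  by (simp add: affine_word_eq M margulis_affine_map margulis_word_def)

lemma linear_word_rotate:
  "linear_word M (w @ u)
    = matrix_inv (linear_word M u) ** linear_word M (u @ w) ** matrix_inv (matrix_inv (linear_word M u))"
  by (simp add: linear_word_append lorentz_inv_inv matrix_mul_assoc lorentz_inv)

lemma x_zero_rotate:
  assumes "hyperbolic (linear_word M (u @ w))"
  shows "x_zero (linear_word M (w @ u)) = matrix_inv (linear_word M u) *v x_zero (linear_word M (u @ w))"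
  by (subst linear_word_rotate, rule x_zero_conj[OF assms]) (simp add: lorentz_inv)

text \<open>A rotation is a conjugation by the prefix \<open>u\<close>. It suffices to transport the
  axis along, since both \<open>w\<close> and the inverse of \<open>u\<close> carry the axis of
  \<open>u @ w\<close> to that of \<open>w @ u\<close>.\<close>

lemma margulis_word_rotate:
  assumes "hyperbolic (linear_word M (u @ w))"
  shows "margulis_word v (w @ u) = margulis_word v (u @ w)"
proof -
  let ?x = "x_zero (linear_word M (u @ w))" and ?U = "linear_word M u" and ?W = "linear_word M w"
  have "?U *v (?W *v ?x) = ?x"
    using x_zero_fixed[OF assms] by (simp add: linear_word_append matrix_vector_mul_assoc)
  then have "?W *v ?x = matrix_inv ?U *v ?x"
    by (metis linear_word_lorentz lorentz_inv_cancel(2))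
  then have "mink (?W *v word_translation M v u) (matrix_inv ?U *v ?x)
      = mink (word_translation M v u) ?x"
    by (metis linear_word_lorentz lorentz_mink)
  moreover have "mink (word_translation M v w) (matrix_inv ?U *v ?x)
      = mink (?U *v word_translation M v w) ?x"
    by (simp add: lorentz_mink_inv)
  ultimately show ?thesis
    by (simp add: margulis_word_def x_zero_rotate[OF assms] word_translation_append)
qed

text \<open>In each summand the linear prefix is moved to the other side of \<open>mink\<close>,
  where it turns the axis of the word into the axis of the word rotated to start at that
  piece.\<close>

lemma margulis_word_concat:
  assumes "hyperbolic (linear_word M (concat ws))"
  shows "margulis_word v (concat ws)
    = (\<Sum>j<length ws. mink (word_translation M v (hd (rotate j ws)))
        (x_zero (linear_word M (concat (rotate j ws)))))"
  unfolding margulis_word_def word_translation_concat mink_sum_left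
proof (rule sum.cong[OF refl])
  fix j assume j: "j \<in> {..<length ws}"
  have c: "concat ws = concat (take j ws) @ concat (drop j ws)"
    by (metis append_take_drop_id concat_append)
  have r: "rotate j ws = drop j ws @ take j ws"
    using j by (simp add: rotate_drop_take)
  have "hd (rotate j ws) = ws ! j"
    using j by (simp add: r hd_drop_conv_nth)
  then show "mink (linear_word M (concat (take j ws)) *v word_translation M v (ws ! j))
      (x_zero (linear_word M (concat ws)))
    = mink (word_translation M v (hd (rotate j ws))) (x_zero (linear_word M (concat (rotate j ws))))"
    using assms x_zero_rotate[of "concat (take j ws)" "concat (drop j ws)"]
    by (simp add: r lorentz_mink_inv c[symmetric])
qed

end

subsection \<open>Ping-pong\<close>

lemma continuous_on_stereo:
  assumes "z \<in> future_rays" "S \<subseteq> future_rays" "z \<notin> S"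
  shows "continuous_on S (stereo z)"
  unfolding stereo_def
proof (intro continuous_intros)
  show "\<forall>x\<in>S. mink z x \<noteq> 0"
    using assms mink_future_rays_neg[of z] by (metis less_irrefl subsetD)
qed

lemma continuous_on_ray_action:
  assumes "M \<in> lorentz" "S \<subseteq> future_rays"
  shows "continuous_on S (ray_action M)"
  unfolding ray_action_def ray_def
proof (intro continuous_intros linear_continuous_on_compose[where g = "(*v) M"] ballI)
  show "norm (M *v x) \<noteq> 0" if "x \<in> S" for x
    using assms that ray_in_future_rays(2)[OF lorentz_future[OF assms(1) future_raysD(1)], of x]
    by auto
qed

text \<open>Intermediate value theorem in the coordinate seen from \<open>z\<close>: the
  displacement is non-negative at the minimum of the coordinate on \<open>S\<close> and non-positive
  at its maximum.\<close>

lemma ray_action_fixed_point: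
  assumes M: "M \<in> lorentz" and S: "S \<subseteq> future_rays" "connected S" "compact S" "S \<noteq> {}"
    and z: "z \<in> future_rays" "z \<notin> S" and inv: "ray_action M ` S \<subseteq> S"
  obtains b where "b \<in> S" "ray_action M b = b"
proof -
  let ?d = "\<lambda>y. stereo z (ray_action M y) - stereo z y"
  have c: "continuous_on S (stereo z)"
    by (rule continuous_on_stereo) (use S z in auto)
  then have "continuous_on S (\<lambda>y. stereo z (ray_action M y))"
    by (rule continuous_on_compose2[OF _ continuous_on_ray_action[OF M S(1)] inv])
  with c have "continuous_on S ?d"
    by (intro continuous_intros)
  then have conn: "connected (?d ` S)"
    using S by (intro connected_continuous_image)
  obtain p where p: "p \<in> S" "\<And>y. y \<in> S \<Longrightarrow> stereo z p \<le> stereo z y"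
    using continuous_attains_inf[OF S(3,4) c] by blast
  obtain r where r: "r \<in> S" "\<And>y. y \<in> S \<Longrightarrow> stereo z y \<le> stereo z r"
    using continuous_attains_sup[OF S(3,4) c] by blast
  have "?d p \<ge> 0" "?d r \<le> 0"
    using p r inv by auto
  then have "0 \<in> ?d ` S"
    using p(1) r(1) by (intro connectedD_interval[OF conn, of "?d r" "?d p" 0] imageI)
  then obtain y where y: "y \<in> S" "?d y = 0" by auto
  have "ray_action M y = y"
  proof (rule ccontr)
    assume ne: "ray_action M y \<noteq> y"
    have m: "ray_action M y \<in> S" using y inv by auto
    have "det3 z y (ray_action M y) \<noteq> 0"
      using ne m y z S by (intro det3_future_rays_nonzero) auto
    then have "det3 z y (ray_action M y) > 0 \<or> det3 z (ray_action M y) y > 0"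
      by (auto simp: det3_swap[of z y "ray_action M y"])
    moreover have "y \<in> future_rays" "ray_action M y \<in> future_rays" "y \<noteq> z" "ray_action M y \<noteq> z"
      using y m z S by auto
    ultimately show False
      using y(2) det3_pos_iff_stereo[OF z(1)] by (metis diff_0_right diff_eq_diff_eq less_irrefl)
  qed
  with y that show ?thesis by blast
qed

text \<open>The eigenvalue at the attracting fixed point exceeds one because otherwise the orbit of a
  third ray could not stay in a compact set avoiding the other fixed point.\<close>

lemma hyp_frame_of_trapping:
  assumes M: "M \<in> lorentz" and a: "a \<in> future_rays" "ray_action M a = a"
    and b: "b \<in> future_rays" "ray_action M b = b" "a \<noteq> b"
    and S: "compact S" "S \<subseteq> future_rays" "a \<notin> S"
    and y: "y \<in> future_rays" "y \<notin> S" "y \<noteq> a" "y \<noteq> b"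
    and trap: "\<And>k. (ray_action M ^^ Suc k) y \<in> S"
  obtains \<mu> where "hyp_frame M a b \<mu>"
proof -
  obtain \<nu> where \<nu>: "\<nu> > 0" "M *v a = \<nu> *\<^sub>R a"
    using ray_action_scale[OF M a(1)] a(2) by metis
  obtain \<mu> where \<mu>: "\<mu> > 0" "M *v b = \<mu> *\<^sub>R b"
    using ray_action_scale[OF M b(1)] b(2) by metis
  have "mink a b = \<nu> * \<mu> * mink a b"
    using lorentz_mink[OF M, of a b] unfolding \<nu>(2) \<mu>(2) mink_simps by (simp only: ac_simps)
  moreover have "mink a b \<noteq> 0"
    using mink_future_rays_neg[OF a(1) b(1) b(3)] by simp
  ultimately have nm: "\<nu> * \<mu> = 1"
    by simp
  then have \<nu>_eq: "\<nu> = inverse \<mu>"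
    using \<mu>(1) by (simp add: field_simps)
  have ma: "mink (M *v x) a = \<mu> * mink x a" for x
  proof -
    have "\<nu> * mink (M *v x) a = mink x a"
      using lorentz_mink[OF M, of x a] \<nu> by simp
    then show ?thesis
      using \<mu>(1) by (simp add: \<nu>_eq field_simps)
  qed
  have mb: "mink (M *v x) b = inverse \<mu> * mink x b" for x
  proof -
    have "\<mu> * mink (M *v x) b = mink x b"
      using lorentz_mink[OF M, of x b] \<mu> by simp
    then show ?thesis
      using \<mu>(1) by (simp add: field_simps)
  qed
  have "\<mu> > 1"
  proof (rule ccontr)
    assume "\<not> \<mu> > 1"
    then consider "\<mu> = 1" | "\<mu> < 1" by linarith
    then show False
    proof cases
      \<comment> \<open>Here \<open>M\<close> fixes the basis formed by \<open>a\<close>,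
        \<open>b\<close> and their axis, so \<open>y\<close> would not move and could not enter
        \<open>S\<close>.\<close>
      case 1
      have n: "M *v null_axis a b = null_axis a b"
        using \<nu> \<mu> 1 by (simp add: lorentz_null_axis[OF M] \<nu>_eq)
      have "mink (M *v y) (null_axis a b) = mink y (null_axis a b)"
        using lorentz_mink[OF M, of y "null_axis a b"] n by simp
      then have "M *v y = y"
        using null_frame_expand[OF a(1) b(1) b(3), of "M *v y"]
          null_frame_expand[OF a(1) b(1) b(3), of y] 1 by (simp add: ma mb)
      then have "ray_action M y = y"
        using y by (simp add: ray_action_def ray_future_ray)
      then show False
        using trap[of 0] y by simp
    next
      case 2
      have "S \<noteq> {}" using trap by blast
      moreover have "continuous_on S (\<lambda>x. mink x a)"
        by (intro continuous_intros)
      ultimately obtain s where s: "s \<in> S" "\<And>x. x \<in> S \<Longrightarrow> mink x a \<le> mink s a"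
        using continuous_attains_sup[OF S(1)] by metis
      define \<epsilon> where "\<epsilon> = - mink s a"
      have \<epsilon>: "\<epsilon> > 0"
        using mink_future_rays_neg[of s a] s S a by (auto simp: \<epsilon>_def)
      \<comment> \<open>The scaling factor \<open>c\<close> of the orbit is unknown, but the
        pairings with \<open>a\<close> and \<open>b\<close> scale by inverse powers of
        \<open>\<mu>\<close>. Combining them eliminates \<open>c\<close> and leaves a bound that
        tends to zero for \<open>\<mu> < 1\<close>.\<close>
      have bound: "\<epsilon> * (- mink y b) \<le> 2 * (\<mu> ^ k * \<mu> ^ k) * (- mink y a)" if "k \<ge> 1" for k
      proof -
        let ?r = "(ray_action M ^^ k) y"
        have "?r \<in> future_rays \<and> (\<exists>c>0. c *\<^sub>R ?r = ((\<lambda>x. M *v x) ^^ k) y)"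
        proof (induction k)
          case 0
          show ?case using y by (auto intro: exI[of _ 1])
        next
          case (Suc k)
          then obtain c where c: "c > 0" "c *\<^sub>R (ray_action M ^^ k) y = ((\<lambda>x. M *v x) ^^ k) y"
            by blast
          obtain d where d: "d > 0"
            "M *v (ray_action M ^^ k) y = d *\<^sub>R ray_action M ((ray_action M ^^ k) y)"
            using Suc ray_action_scale[OF M] by metis
          have "(c * d) *\<^sub>R (ray_action M ^^ Suc k) y = M *v (c *\<^sub>R (ray_action M ^^ k) y)"
            by (simp add: mat_vec_simps d)
          also have "\<dots> = ((\<lambda>x. M *v x) ^^ Suc k) y"
            by (simp add: c(2))
          finally have "(c * d) *\<^sub>R (ray_action M ^^ Suc k) y = ((\<lambda>x. M *v x) ^^ Suc k) y" .
          moreover have "c * d > 0"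
            using c d by simp
          ultimately show ?case
            using Suc M by (auto simp: ray_action_mem simp del: scaleR_scaleR)
        qed
        then obtain c where c: "c > 0" "c *\<^sub>R ?r = ((\<lambda>x. M *v x) ^^ k) y" and rF: "?r \<in> future_rays"
          by blast
        have pa: "mink (((\<lambda>x. M *v x) ^^ k) y) a = \<mu> ^ k * mink y a" for k
          by (induction k) (simp_all add: ma)
        have ra: "c * mink ?r a = \<mu> ^ k * mink y a"
          using pa[of k] unfolding c(2)[symmetric] mink_simps .
        have pb: "\<mu> ^ k * mink (((\<lambda>x. M *v x) ^^ k) y) b = mink y b" for k
        proof (induction k)
          case (Suc k)
          have "\<mu> ^ Suc k * mink (((\<lambda>x. M *v x) ^^ Suc k) y) b
              = \<mu> * inverse \<mu> * (\<mu> ^ k * mink (((\<lambda>x. M *v x) ^^ k) y) b)"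
            by (simp only: funpow.simps comp_apply mb power_Suc ac_simps)
          then show ?case
            using \<mu>(1) Suc by simp
        qed simp
        have rb: "\<mu> ^ k * (c * mink ?r b) = mink y b"
          using pb[of k] unfolding c(2)[symmetric] mink_simps .
        have "?r \<in> S"
          using trap[of "k - 1"] that by simp
        then have "\<epsilon> \<le> - mink ?r a"
          using s by (auto simp: \<epsilon>_def)
        moreover have "- mink ?r b \<le> 2" "- mink ?r b \<ge> 0"
          using mink_future_rays_bound[OF rF b(1)] rF b(1) by (simp_all add: mink_future_rays)
        ultimately have "\<epsilon> * (- mink ?r b) \<le> (- mink ?r a) * 2"
          using \<epsilon> by (intro mult_mono) auto
        then have "(\<mu> ^ k * c) * (\<epsilon> * (- mink ?r b)) \<le> (\<mu> ^ k * c) * ((- mink ?r a) * 2)"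
          using \<mu>(1) c(1) by (intro mult_left_mono) auto
        also have "(\<mu> ^ k * c) * (\<epsilon> * (- mink ?r b)) = \<epsilon> * (- mink y b)"
          by (simp add: rb[symmetric])
        also have "(\<mu> ^ k * c) * ((- mink ?r a) * 2) = 2 * \<mu> ^ k * (- (c * mink ?r a))"
          by simp
        also have "\<dots> = 2 * (\<mu> ^ k * \<mu> ^ k) * (- mink y a)"
          unfolding ra by simp
        finally show ?thesis .
      qed
      have lim: "(\<lambda>k. \<mu> ^ k) \<longlonglongrightarrow> 0"
        using \<mu>(1) 2 by (intro LIMSEQ_realpow_zero) auto
      have "(\<lambda>k. 2 * (\<mu> ^ k * \<mu> ^ k) * (- mink y a)) \<longlonglongrightarrow> 2 * (0 * 0) * (- mink y a)"
        by (intro tendsto_mult tendsto_const lim)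
      then have "\<epsilon> * (- mink y b) \<le> 2 * (0 * 0) * (- mink y a)"
        by (rule LIMSEQ_le_const) (use bound in blast)
      then have "mink y b \<ge> 0"
        using \<epsilon> by (simp add: mult_le_0_iff zero_le_mult_iff)
      then show False
        using mink_future_rays_neg[OF y(1) b(1) y(4)] by simp
    qed
  qed
  then have "hyp_frame M a b \<mu>"
    using M a b \<mu> \<nu> by (simp add: hyp_frame_def \<nu>_eq)
  then show ?thesis by (rule that)
qed

text \<open>With two generators there are four letters. The spare one supplies a test ray lying in
  neither the attracting nor the repelling sector of a word.\<close>

lemma other_letter:
  fixes l k :: "gen \<times> bool"
  obtains c where "c \<noteq> l" "c \<noteq> k"
proof -
  have "\<exists>c. c \<noteq> l \<and> c \<noteq> k"
  proof (rule ccontr)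
    assume "\<not> ?thesis"
    then have "c = l \<or> c = k" for c by blast
    from this[of "(Gen_g, True)"] this[of "(Gen_g, False)"] this[of "(Gen_h, True)"]
    show False by auto
  qed
  then show ?thesis using that by blast
qed

section \<open>Dynamics of words under a Schottky system\<close>

locale schottky = lorentz_family M for M :: "gen \<Rightarrow> real^3^3" +
  fixes A :: "gen \<Rightarrow> bool \<Rightarrow> (real^3) set"
  assumes system: "schottky_system M A"
begin

definition sector :: "gen \<times> bool \<Rightarrow> (real^3) set" where
  "sector l = A (fst l) (snd l)"

lemma sector_interval: "closed_conical_interval (sector l)"
  using system by (simp add: schottky_system_def sector_def)

lemma sector_subset: "sector l \<subseteq> future_rays"
  using sector_interval[of l] by (simp add: closed_conical_interval_def conical_interval_def)

lemma sector_connected: "connected (sector l)"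
  using sector_interval[of l] by (simp add: closed_conical_interval_def conical_interval_def)

lemma sector_compact: "compact (sector l)"
proof -
  have "closedin rays_topology (sector l)"
    using sector_interval[of l] by (simp add: closed_conical_interval_def)
  then show ?thesis
    using compact_future_rays closedin_compact by blast
qed

lemma sector_disjoint: "l \<noteq> k \<Longrightarrow> sector l \<inter> sector k = {}"
  using system disjoint_family_onD[of "\<lambda>(i, s). A i s" UNIV l k]
  unfolding schottky_system_def sector_def by (simp add: case_prod_unfold)

lemma sector_image: "ray_action (M i) ` sector (i, False) = rays_topology closure_of (future_rays - sector (i, True))"
  using system by (simp add: schottky_system_def sector_def)

text \<open>Only the fact that a closure contains its set is used. For a positive letter, an image
  missing the sector would come from the opposite sector, and injectivity puts \<open>x\<close>
  there; for a negative letter, \<open>x\<close> is itself such an image.\<close>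

lemma ping_pong_letter:
  assumes x: "x \<in> future_rays" "x \<notin> sector (flip l)"
  shows "ray_action (letter_matrix M l) x \<in> sector l"
proof -
  obtain i s where l: "l = (i, s)" by (cases l)
  have cl: "future_rays - sector (i, True) \<subseteq> ray_action (M i) ` sector (i, False)"
    unfolding sector_image by (rule closure_of_subset) auto
  show ?thesis
  proof (cases s)
    case True
    show ?thesis
    proof (rule ccontr)
      assume "ray_action (letter_matrix M l) x \<notin> sector l"
      then have "ray_action (M i) x \<in> future_rays - sector (i, True)"
        using x M l True by (simp add: letter_matrix_def ray_action_mem)
      then obtain y where y: "y \<in> sector (i, False)" "ray_action (M i) x = ray_action (M i) y"
        using cl by auto
      then have "x = y"
        using ray_action_inv(2)[OF M x(1)] ray_action_inv(2)[OF M subsetD[OF sector_subset y(1)]]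
        by metis
      then show False
        using x y l True by simp
    qed
  next
    case False
    then obtain y where y: "y \<in> sector (i, False)" "x = ray_action (M i) y"
      using x cl l by auto
    then show ?thesis
      using False l M subsetD[OF sector_subset y(1)] by (simp add: letter_matrix_def)
  qed
qed

text \<open>If one sector were empty, ping-pong would put the whole circle into the opposite sector.
  Disjointness then empties both sectors of the other generator, which contradicts ping-pong for
  that generator.\<close>

lemma sector_nonempty: "sector l \<noteq> {}"
proof
  assume empty: "sector l = {}"
  obtain i s where l: "l = (i, s)" by (cases l)
  have full: "future_rays \<subseteq> sector (flip l)"
  proof
    fix x assume x: "x \<in> future_rays"
    show "x \<in> sector (flip l)"
      using ping_pong_letter[OF x, of l] empty by blast
  qed
  obtain j where j: "j \<noteq> i"
    by (metis gen.distinct(1))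
  have none: "sector (j, t) = {}" for t
  proof -
    have "(j, t) \<noteq> flip l"
      using j l by simp
    then show ?thesis
      using sector_disjoint full sector_subset by blast
  qed
  obtain x where "x \<in> future_rays"
    using future_rays_nonempty by blast
  then show False
    using ping_pong_letter[of x "(j, True)"] none by simp
qed

lemma ping_pong:
  assumes "reduced w" "w \<noteq> []" "x \<in> future_rays" "x \<notin> sector (flip (last w))"
  shows "ray_action (linear_word M w) x \<in> sector (hd w)"
  using assms
proof (induction w)
  case (Cons l w)
  show ?case
  proof (cases "w = []")
    case True
    then show ?thesis
      using Cons.prems ping_pong_letter by simp
  next
    case False
    then have "l \<noteq> flip (hd w)" and w: "reduced w"
      using Cons.prems by (auto simp: reduced_iff successively_Cons)
    then have ne: "flip l \<noteq> hd w" by (metis flip_simps(2))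
    have "ray_action (linear_word M w) x \<in> sector (hd w)"
      using Cons False w by simp
    moreover from this ne have "ray_action (linear_word M w) x \<notin> sector (flip l)"
      using sector_disjoint by blast
    ultimately have "ray_action (letter_matrix M l) (ray_action (linear_word M w) x) \<in> sector l"
      using ping_pong_letter sector_subset by blast
    then show ?thesis
      using Cons.prems by (simp add: ray_action_mult)
  qed
qed simp

text \<open>The word maps its first sector into itself, which yields the ray \<open>b\<close>; the
  inverse word yields \<open>a\<close> in the same way. The orbit of a ray from a third sector
  enters the first sector at once and stays there, so \<open>b\<close> is attracting.\<close>

lemma hyp_frame_word:
  assumes w: "cyclically_reduced w" "w \<noteq> []"
  obtains a b \<mu> where "hyp_frame (linear_word M w) a b \<mu>" "b \<in> sector (hd w)" "a \<in> sector (flip (last w))"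
proof -
  have fixed: "\<exists>b \<in> sector (hd u). ray_action (linear_word M u) b = b"
    if u: "cyclically_reduced u" "u \<noteq> []" for u
  proof -
    have r: "reduced u" "hd u \<noteq> flip (last u)"
      using u by (auto simp: cyclically_reduced_iff)
    obtain z where z: "z \<in> sector (flip (last u))"
      using sector_nonempty by blast
    have "ray_action (linear_word M u) ` sector (hd u) \<subseteq> sector (hd u)"
      using ping_pong[OF r(1) u(2)] sector_disjoint[OF r(2)] sector_subset by blast
    moreover have "z \<in> future_rays" "z \<notin> sector (hd u)"
      using z sector_subset sector_disjoint[OF r(2)] by blast+
    ultimately show ?thesis
      using ray_action_fixed_point[OF linear_word_lorentz sector_subset sector_connected sector_compact sector_nonempty]
      by metis
  qed
  let ?M = "linear_word M w"
  have r: "reduced w" "hd w \<noteq> flip (last w)"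
    using w by (auto simp: cyclically_reduced_iff)
  obtain b where b: "b \<in> sector (hd w)" "ray_action ?M b = b"
    using fixed[OF w] by blast
  obtain a where a: "a \<in> sector (flip (last w))" "ray_action (matrix_inv ?M) a = a"
    using fixed[OF cyclically_reduced_inv_word[OF w(1)]] w
    by (auto simp: hd_last_inv_word linear_word_inv)
  have aF: "a \<in> future_rays" and bF: "b \<in> future_rays"
    using a b sector_subset by blast+
  have a': "ray_action ?M a = a"
    using ray_action_inv(1)[OF linear_word_lorentz aF] a(2) by metis
  have disj: "sector (hd w) \<inter> sector (flip (last w)) = {}"
    by (rule sector_disjoint[OF r(2)])
  obtain c where c: "c \<noteq> hd w" "c \<noteq> flip (last w)"
    by (rule other_letter)
  obtain y where y: "y \<in> sector c"
    using sector_nonempty by blast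
  have yF: "y \<in> future_rays" and ny: "y \<notin> sector (hd w)" "y \<notin> sector (flip (last w))"
    using y sector_subset sector_disjoint[OF c(1)] sector_disjoint[OF c(2)] by blast+
  have "(ray_action ?M ^^ Suc k) y \<in> sector (hd w)" for k
  proof (induction k)
    case 0
    then show ?case
      using ping_pong[OF r(1) w(2) yF ny(2)] by simp
  next
    case (Suc k)
    then have "(ray_action ?M ^^ Suc k) y \<in> future_rays" "(ray_action ?M ^^ Suc k) y \<notin> sector (flip (last w))"
      using sector_subset disj by blast+
    then show ?case
      using ping_pong[OF r(1) w(2)] by simp
  qed
  then obtain \<mu> where "hyp_frame ?M a b \<mu>"
    using hyp_frame_of_trapping[OF linear_word_lorentz aF a' bF b(2) _ sector_compact sector_subset _ yF ny(1)]
      a b disj ny by blast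
  with a b that show ?thesis by blast
qed

lemma hyperbolic_word: "cyclically_reduced w \<Longrightarrow> w \<noteq> [] \<Longrightarrow> hyperbolic (linear_word M w)"
  unfolding hyperbolic_def using hyp_frame_word by metis

lemma hyp_frame_generator:
  obtains \<mu> where "hyp_frame (M i) (x_minus (M i)) (x_plus (M i)) \<mu>"
    "x_plus (M i) \<in> sector (i, True)" "x_minus (M i) \<in> sector (i, False)"
proof -
  have "cyclically_reduced [(i, True)]"
    by (simp add: cyclically_reduced_iff reduced_iff)
  then obtain a b \<mu> where "hyp_frame (M i) a b \<mu>" "b \<in> sector (i, True)" "a \<in> sector (i, False)"
    using hyp_frame_word[of "[(i, True)]"] by (auto simp: letter_matrix_def)
  then show ?thesis
    using that hyp_frame_x_minus hyp_frame_x_plus by blast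
qed

end

subsection \<open>Positivity of the base deformation\<close>

lemma connected_pos:
  assumes "connected S" "continuous_on S f" "\<And>x. x \<in> S \<Longrightarrow> f x \<noteq> (0::real)" "a \<in> S" "f a > 0" "b \<in> S"
  shows "f b > 0"
proof (rule connected_avoids_zero)
  show "connected (f ` S)"
    by (rule connected_continuous_image) fact+
qed (use assms in force)+

locale crossing_schottky = schottky M A for M A +
  assumes crossing: "transversal (M Gen_g) (M Gen_h)"
    and oriented: "positive_triple (x_minus (M Gen_g)) (x_minus (M Gen_h)) (x_plus (M Gen_g))"
begin

abbreviation "gp \<equiv> x_plus (M Gen_g)"
abbreviation "gm \<equiv> x_minus (M Gen_g)"
abbreviation "hp \<equiv> x_plus (M Gen_h)"
abbreviation "hm \<equiv> x_minus (M Gen_h)"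

text \<open>An endpoint of the interval in Property C.\<close>

definition base_vec :: "real^3" where
  "base_vec = ray_action (M Gen_g) hp"

lemma generator_rays:
  "gp \<in> sector (Gen_g, True)" "gm \<in> sector (Gen_g, False)"
  "hp \<in> sector (Gen_h, True)" "hm \<in> sector (Gen_h, False)"
  using hyp_frame_generator by blast+

lemma generator_rays_future: "gp \<in> future_rays" "gm \<in> future_rays" "hp \<in> future_rays" "hm \<in> future_rays"
  using generator_rays sector_subset by blast+

lemma base_vec_future: "base_vec \<in> future_rays"
  by (simp add: base_vec_def ray_action_mem M generator_rays_future)

text \<open>The common timelike vector \<open>u\<close> is a combination of \<open>hm\<close> and
  \<open>hp\<close> with coefficients of equal sign, and it lies in the plane through
  \<open>gm\<close> and \<open>gp\<close>. So that plane separates \<open>hm\<close> from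
  \<open>hp\<close>.\<close>

lemma crossing_order: "det3 gm gp hp > 0"
proof -
  obtain u where u: "timelike u" "perp (x_zero (M Gen_g)) \<inter> perp (x_zero (M Gen_h)) = span {u}"
    using crossing by (auto simp: transversal_def)
  have "u \<in> span {u}"
    by (simp add: span_base)
  then have "u \<in> perp (x_zero (M Gen_g)) \<inter> perp (x_zero (M Gen_h))"
    unfolding u(2) .
  then have ug: "mink u (x_zero (M Gen_g)) = 0" and uh: "mink u (x_zero (M Gen_h)) = 0"
    by (simp_all add: perp_def)
  obtain \<mu> where Hg: "hyp_frame (M Gen_g) gm gp \<mu>"
    using hyp_frame_generator by metis
  obtain \<nu> where Hh: "hyp_frame (M Gen_h) hm hp \<nu>"
    using hyp_frame_generator by metis
  note Dg = hyp_frameD[OF Hg] and Dh = hyp_frameD[OF Hh]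
  have mg: "mink gm gp < 0" and mh: "mink hm hp < 0"
    using mink_future_rays_neg Dg Dh by auto
  define s t where "s = mink u hp / mink hm hp" and "t = mink u hm / mink hm hp"
  have "u = (mink u hp / mink hm hp) *\<^sub>R hm + (mink u hm / mink hm hp) *\<^sub>R hp
      + mink u (x_zero (M Gen_h)) *\<^sub>R null_axis hm hp"
    unfolding hyp_frame_x_zero[OF Hh] by (rule null_frame_expand[OF Dh(2,3,5)])
  then have us: "u = s *\<^sub>R hm + t *\<^sub>R hp"
    by (simp add: uh s_def t_def)
  have "mink u u = 2 * (s * t) * mink hm hp"
    using Dh(2,3) by (simp add: us future_raysD mink_commute[of hp hm])
  then have st: "s * t > 0"
    using u(1) mh by (simp add: timelike_def mult_less_0_iff zero_less_mult_iff)
  have "mink u (null_axis gm gp) = 0"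
    using ug by (simp add: hyp_frame_x_zero[OF Hg])
  then have "det3 u gm gp = 0"
    using mg by (simp add: mink_null_axis)
  moreover have "det3 u gm gp = s * det3 hm gm gp + t * det3 hp gm gp"
    by (simp add: us det3_expand algebra_simps)
  ultimately have "t * (s * det3 hm gm gp + t * det3 hp gm gp) = 0"
    by simp
  then have "(t * t) * det3 hp gm gp = (s * t) * (- det3 hm gm gp)"
    by (simp add: algebra_simps)
  moreover have "- det3 hm gm gp > 0"
    using oriented unfolding positive_triple_def det3_expand by (simp add: algebra_simps)
  ultimately have "(t * t) * det3 hp gm gp > 0"
    using st by (metis mult_pos_pos)
  then have "det3 hp gm gp > 0"
    by (metis not_square_less_zero zero_less_mult_iff)
  then show ?thesis
    by (simp add: det3_expand algebra_simps)
qed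

text \<open>Crossing axes and the normalization give the cyclic order \<open>gm\<close>,
  \<open>hm\<close>, \<open>gp\<close>, \<open>hp\<close> of the four fixed rays.\<close>

lemma generator_order: "det3 hp hm gp > 0" "det3 hp gm hm > 0"
proof -
  have "det3 gm hm gp > 0"
    using oriented by (simp add: positive_triple_def)
  then have "det3 gm hm hp > 0" "det3 hm gp hp > 0"
    using cyclic_order_trans[OF generator_rays_future(2,4,1,3)] crossing_order by auto
  then show "det3 hp hm gp > 0" "det3 hp gm hm > 0"
    by (simp_all add: det3_expand algebra_simps)
qed

lemma sectors_distinct: "x \<in> sector l \<Longrightarrow> y \<in> sector k \<Longrightarrow> l \<noteq> k \<Longrightarrow> x \<noteq> y"
  using sector_disjoint by blast

text \<open>The determinant cannot vanish on a sector of \<open>g\<close>, which avoids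
  \<open>hp\<close> and \<open>hm\<close>. By connectedness its sign is that at the fixed ray of
  \<open>g\<close> in the sector.\<close>

lemma side_plus:
  assumes "y \<in> sector (Gen_g, True)"
  shows "det3 hp hm y > 0"
proof (rule connected_pos[where f = "det3 hp hm", OF sector_connected _ _ generator_rays(1) generator_order(1) assms])
  show "continuous_on (sector (Gen_g, True)) (det3 hp hm)"
    by (intro continuous_intros)
  show "det3 hp hm x \<noteq> 0" if "x \<in> sector (Gen_g, True)" for x
    using sectors_distinct[OF generator_rays(3) generator_rays(4)]
      sectors_distinct[OF generator_rays(4) that] sectors_distinct[OF that generator_rays(3)]
      generator_rays_future that sector_subset
    by (intro det3_future_rays_nonzero) auto
qed

lemma side_minus:
  assumes "z \<in> sector (Gen_g, False)"
  shows "det3 hp z hm > 0"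
proof (rule connected_pos[where f = "\<lambda>z. det3 hp z hm",
      OF sector_connected _ _ generator_rays(2) generator_order(2) assms])
  show "continuous_on (sector (Gen_g, False)) (\<lambda>z. det3 hp z hm)"
    by (intro continuous_intros)
  show "det3 hp x hm \<noteq> 0" if "x \<in> sector (Gen_g, False)" for x
    using sectors_distinct[OF generator_rays(4) generator_rays(3)]
      sectors_distinct[OF that generator_rays(4)] sectors_distinct[OF generator_rays(3) that]
      generator_rays_future that sector_subset
    by (intro det3_future_rays_nonzero) auto
qed

lemma h_word_fixes:
  assumes "\<forall>l \<in> set w. fst l = Gen_h"
  shows "ray_action (linear_word M w) hp = hp" "ray_action (linear_word M w) hm = hm"
proof -
  obtain \<nu> where H: "hyp_frame (M Gen_h) hm hp \<nu>"
    using hyp_frame_generator by metis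
  note D = hyp_frameD[OF H]
  have "ray_action (M Gen_h) hp = hp" "ray_action (M Gen_h) hm = hm"
    using ray_action_eigenvector[OF D(3,7)] ray_action_eigenvector[OF D(2,6)] D(4) by auto
  then have "ray_action (letter_matrix M l) hp = hp" "ray_action (letter_matrix M l) hm = hm"
    if "fst l = Gen_h" for l
    using that ray_action_inv(2)[OF M D(3), of Gen_h] ray_action_inv(2)[OF M D(2), of Gen_h]
    by (auto simp: letter_matrix_def)
  then show "ray_action (linear_word M w) hp = hp" "ray_action (linear_word M w) hm = hm"
    using assms D(2,3) by (induction w) (simp_all add: ray_action_mult)
qed

text \<open>Cyclically, the attracting ray of \<open>w\<close> comes before \<^const>\<open>base_vec\<close> inside the interval of
  the first letter, and the repelling one comes after that interval.\<close>

lemma base_vec_positive: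
  assumes w: "cyclically_reduced w" "w = (Gen_g, True) # ls @ r"
    and ls: "\<forall>l \<in> set ls. fst l = Gen_h" and r: "r = [] \<or> hd r = (Gen_g, True)"
  shows "mink base_vec (x_zero (linear_word M w)) > 0"
proof -
  have ne: "w \<noteq> []" using w by simp
  obtain a b \<mu> where H: "hyp_frame (linear_word M w) a b \<mu>"
    and b: "b \<in> sector (hd w)" and a: "a \<in> sector (flip (last w))"
    using hyp_frame_word[OF w(1) ne] .
  note D = hyp_frameD[OF H]
  have b': "b \<in> sector (Gen_g, True)" using b w by simp
  have red: "reduced w" and "last w \<noteq> flip (Gen_g, True)"
    using w by (auto simp: cyclically_reduced_iff)
  then have fl: "flip (last w) \<noteq> (Gen_g, True)"
    by (metis flip_simps(2))
  \<comment> \<open>Following the fixed ray \<open>b\<close> through one pass of the word: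
    \<open>r\<close> is applied first and leaves the ray in the sector of \<open>g\<close>, from
    where \<open>ls\<close> and finally \<open>g\<close> return it to \<open>b\<close>.\<close>
  define y where "y = ray_action (linear_word M r) b"
  have y: "y \<in> sector (Gen_g, True)"
  proof (cases "r = []")
    case True
    then show ?thesis using b' D by (simp add: y_def)
  next
    case False
    have "reduced r"
      using red unfolding w(2) reduced_iff append_Cons[symmetric] successively_append_iff by blast
    moreover have "b \<notin> sector (flip (last r))"
      using sector_disjoint[OF fl] b' w False by auto
    ultimately show ?thesis
      using ping_pong[OF _ False D(3)] r False by (simp add: y_def)
  qed
  define L where "L = linear_word M ls"
  have L: "L \<in> lorentz" by (simp add: L_def)
  have yF: "y \<in> future_rays" using y sector_subset by blast
  have "b = ray_action (linear_word M w) b"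
    using ray_action_eigenvector[OF D(3,7)] D(4) by simp
  also have "\<dots> = ray_action (M Gen_g) (ray_action L y)"
    using D(3) by (simp add: w L_def y_def linear_word_append ray_action_mult lorentz_mult M
        ray_action_mem letter_matrix_def)
  finally have b_eq: "b = ray_action (M Gen_g) (ray_action L y)" .
  define z where "z = ray_action (matrix_inv (M Gen_g)) a"
  have "a \<notin> sector (Gen_g, True)"
    using a sector_disjoint[OF fl] by blast
  then have z: "z \<in> sector (Gen_g, False)"
    using ping_pong_letter[of a "(Gen_g, False)"] D(2) by (simp add: z_def letter_matrix_def)
  have a_eq: "a = ray_action (M Gen_g) z"
    using D(2) M by (simp add: z_def)
  have zF: "z \<in> future_rays" using z sector_subset by blast
  have "det3 (ray_action L hp) (ray_action L hm) (ray_action L y) > 0"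
    using side_plus[OF y] L yF generator_rays_future by (simp add: det3_ray_action)
  then have "det3 hp hm (ray_action L y) > 0"
    using h_word_fixes[OF ls] by (simp add: L_def)
  \<comment> \<open>The rays \<open>hp\<close>, \<open>z\<close>, \<open>hm\<close>,
    \<open>ray_action L y\<close> are in cyclic order. Dropping \<open>hm\<close> and applying
    \<open>g\<close> gives the order of \<open>base_vec\<close>, \<open>a\<close>,
    \<open>b\<close>.\<close>
  then have "det3 hp z (ray_action L y) > 0"
    using cyclic_order_trans(1)[OF generator_rays_future(3) zF generator_rays_future(4) ray_action_mem[OF L yF]]
      side_minus[OF z] by blast
  then have "det3 base_vec a b > 0"
    unfolding base_vec_def a_eq b_eq
    using M zF ray_action_mem[OF L yF] generator_rays_future by (simp add: det3_ray_action)
  then show ?thesis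
    using mink_future_rays_neg[OF D(2,3,5)]
    by (simp add: hyp_frame_x_zero[OF H] mink_null_axis divide_pos_neg)
qed

end

section \<open>Decomposition of words into blocks\<close>

text \<open>Blocks are cut before each letter of the generator \<open>g\<close> because the base
  deformation translates only at these letters; the run of letters of \<open>h\<close> that follows
  is passive.\<close>

definition block :: "bool \<times> gen word \<Rightarrow> gen word" where
  "block b = (Gen_g, fst b) # snd b"

abbreviation block_word :: "(bool \<times> gen word) list \<Rightarrow> gen word" where
  "block_word bs \<equiv> concat (map block bs)"

definition admissible :: "(bool \<times> gen word) list \<Rightarrow> bool" where
  "admissible bs \<longleftrightarrow> bs \<noteq> [] \<and> (\<forall>b \<in> set bs. \<forall>l \<in> set (snd b). fst l = Gen_h)
     \<and> cyclically_reduced (block_word bs)"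

lemma admissible_rotate1:
  assumes "admissible bs"
  shows "admissible (rotate1 bs)"
proof -
  obtain b r where bs: "bs = b # r"
    using assms by (cases bs) (auto simp: admissible_def)
  show ?thesis
    using assms cyclically_reduced_rotate[of "block b" "block_word r"] by (auto simp: admissible_def bs)
qed

lemma admissible_rotate: "admissible bs \<Longrightarrow> admissible (rotate j bs)"
  by (induction j) (simp_all add: admissible_rotate1)

lemma blocks_exist:
  assumes "fst l = Gen_g"
  obtains bs where "bs \<noteq> []" "l # w = block_word bs"
    "\<forall>b \<in> set bs. \<forall>k \<in> set (snd b). fst k = Gen_h"
proof -
  have "\<exists>bs. bs \<noteq> [] \<and> l # w = block_word bs \<and> (\<forall>b \<in> set bs. \<forall>k \<in> set (snd b). fst k = Gen_h)"
    using assms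
  proof (induction w arbitrary: l rule: length_induct)
    case (1 w)
    let ?P = "\<lambda>k. fst k \<noteq> Gen_g"
    let ?b = "(snd l, takeWhile ?P w)"
    have b: "\<forall>k \<in> set (snd ?b). fst k = Gen_h"
      using gen.exhaust by (auto dest!: set_takeWhileD)
    have l: "block ?b = l # takeWhile ?P w"
      using 1 by (simp add: block_def prod_eq_iff)
    show ?case
    proof (cases "dropWhile ?P w")
      case Nil
      then have tw: "takeWhile ?P w = w"
        using takeWhile_dropWhile_id[of ?P w] unfolding Nil by (simp only: append_Nil2)
      have "l # w = block_word [?b]"
        using l unfolding tw by simp
      moreover have "\<forall>b \<in> set [?b]. \<forall>k \<in> set (snd b). fst k = Gen_h"
        using b by simp
      ultimately show ?thesis
        by (intro exI[of _ "[?b]"] conjI list.distinct(2))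
    next
      case (Cons k v)
      then have "fst k = Gen_g"
        using hd_dropWhile[of ?P w] unfolding Cons by simp
      moreover have "length v < length w"
        using length_dropWhile_le[of ?P w] unfolding Cons by simp
      ultimately obtain bs where bs: "k # v = block_word bs"
        "\<forall>b \<in> set bs. \<forall>k \<in> set (snd b). fst k = Gen_h"
        using 1 by blast
      have "l # w = block_word (?b # bs)"
        using l takeWhile_dropWhile_id[of ?P w] unfolding Cons bs(1) by simp
      moreover have "\<forall>b \<in> set (?b # bs). \<forall>k \<in> set (snd b). fst k = Gen_h"
        using b bs(2) by simp
      ultimately show ?thesis
        by (intro exI[of _ "?b # bs"] conjI list.distinct(2))
    qed
  qed
  then show ?thesis using that by blast
qed

section \<open>Pairing the contributions of neighbouring blocks\<close>

text \<open>Property C at the single ray \<open>base_vec\<close>, written as positivity of a sum so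
  that it is symmetric in the two words.\<close>

locale property_C_schottky = crossing_schottky +
  assumes property_C: "w1 \<in> W_set True \<Longrightarrow> w2 \<in> W_set False \<Longrightarrow>
    mink base_vec (x_zero (linear_word M w1)) + mink base_vec (x_zero (linear_word M w2)) > 0"
begin

definition base_deform :: "gen \<Rightarrow> real^3" where
  "base_deform = case_gen base_vec 0"

lemma translation_h_word: "\<forall>l \<in> set w. fst l = Gen_h \<Longrightarrow> word_translation M base_deform w = 0"
  by (induction w) (auto simp: letter_translation_def base_deform_def mat_vec_simps)

lemma translation_block:
  assumes "\<forall>l \<in> set (snd b). fst l = Gen_h"
  shows "word_translation M base_deform (block b)
    = (if fst b then base_vec else - (matrix_inv (M Gen_g) *v base_vec))"
  using translation_h_word[OF assms]
  by (simp add: block_def letter_translation_def base_deform_def mat_vec_simps)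

definition contribution :: "(bool \<times> gen word) list \<Rightarrow> real" where
  "contribution bs = mink (word_translation M base_deform (block (hd bs)))
     (x_zero (linear_word M (block_word bs)))"

lemma contribution_True:
  assumes "admissible bs" "fst (hd bs)"
  shows "contribution bs = mink base_vec (x_zero (linear_word M (block_word bs)))"
  using assms by (cases bs) (simp_all add: contribution_def translation_block admissible_def)

text \<open>Rotating the leading inverse letter to the end and inverting the word makes it start
  with \<open>g\<close>. Inversion negates the axis, which cancels the sign in the translation of
  the inverse letter.\<close>

lemma contribution_False:
  assumes "admissible ((False, ls) # bs)"
  shows "contribution ((False, ls) # bs)
    = mink base_vec (x_zero (linear_word M (inv_word (ls @ block_word bs @ [(Gen_g, False)]))))"
proof -
  let ?u = "ls @ block_word bs"
  have c: "cyclically_reduced ([(Gen_g, False)] @ ?u)"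
    using assms by (simp add: admissible_def block_def)
  have hyp: "hyperbolic (linear_word M ([(Gen_g, False)] @ ?u))"
    by (rule hyperbolic_word[OF c]) simp
  have hyp': "hyperbolic (linear_word M (?u @ [(Gen_g, False)]))"
    by (rule hyperbolic_word[OF cyclically_reduced_rotate[OF c]]) simp
  have "x_zero (linear_word M (?u @ [(Gen_g, False)]))
      = M Gen_g *v x_zero (linear_word M ([(Gen_g, False)] @ ?u))"
    using x_zero_rotate[OF hyp] by (simp add: letter_matrix_def lorentz_inv_inv M)
  then have "mink base_vec (x_zero (linear_word M (inv_word (?u @ [(Gen_g, False)]))))
      = - mink base_vec (M Gen_g *v x_zero (linear_word M ([(Gen_g, False)] @ ?u)))"
    unfolding linear_word_inv x_zero_inv[OF hyp'] by simp
  also have "\<dots> = mink (- (matrix_inv (M Gen_g) *v base_vec)) (x_zero (linear_word M ([(Gen_g, False)] @ ?u)))"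
    using lorentz_mink_inv[OF lorentz_inv(3)[OF M], of Gen_g base_vec] by (simp add: lorentz_inv_inv M)
  also have "\<dots> = contribution ((False, ls) # bs)"
    using assms by (simp add: contribution_def translation_block admissible_def) (simp add: block_def)
  finally show ?thesis by simp
qed

text \<open>The contribution of a letter \<open>g\<close> is charged to the pair it forms with the next letter
  \<open>g\<^sup>\<plusminus>\<^sup>1\<close>, that of a letter \<open>g\<^sup>-\<^sup>1\<close> to the pair with the previous one. Property C
  is needed exactly for the pairs \<open>g h\<^sup>i g\<^sup>-\<^sup>1\<close>.\<close>

definition edge :: "(bool \<times> gen word) list \<Rightarrow> real" where
  "edge bs = (if fst (hd bs) then contribution bs else 0)
     + (if fst (hd (rotate1 bs)) then 0 else contribution (rotate1 bs))"

text \<open>The hypothesis excludes only an inverse letter followed by \<open>g\<close>, where the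
  edge is zero. Equal neighbouring signs leave one term, positive by
  \<open>base_vec_positive\<close>; \<open>g\<close> followed by its inverse leaves two terms, and
  Property C makes their sum positive.\<close>

lemma edge_positive:
  assumes ad: "admissible bs" and "fst (hd bs) \<or> \<not> fst (hd (rotate1 bs))"
  shows "edge bs > 0"
proof -
  obtain s ls rest where bs: "bs = (s, ls) # rest"
    using ad by (cases bs) (auto simp: admissible_def)
  have ls: "\<forall>l \<in> set ls. fst l = Gen_h" and cyc: "cyclically_reduced (block_word bs)"
    using ad by (auto simp: admissible_def bs)
  have ls': "\<forall>l \<in> set (inv_word ls). fst l = Gen_h"
    using ls by auto
  have ad': "admissible (rotate1 bs)"
    by (rule admissible_rotate1[OF ad])
  have T: "contribution bs > 0" if "s" "rest = [] \<or> fst (hd rest)"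
  proof -
    have "block_word rest = [] \<or> hd (block_word rest) = (Gen_g, True)"
      using that by (cases rest) (auto simp: block_def)
    then show ?thesis
      using that contribution_True[OF ad] base_vec_positive[OF cyc _ ls]
      by (simp add: bs block_def)
  qed
  show ?thesis
  \<comment> \<open>A single block is its own cyclic successor, so both neighbouring signs
    agree.\<close>
  proof (cases rest)
    case Nil
    show ?thesis
    proof (cases s)
      case True
      then show ?thesis using T Nil by (simp add: edge_def bs)
    next
      case False
      have "cyclically_reduced (ls @ [(Gen_g, False)])"
        using cyc cyclically_reduced_rotate[of "[(Gen_g, False)]" ls] Nil False
        by (simp add: bs block_def)
      then have "cyclically_reduced (inv_word (ls @ [(Gen_g, False)]))"
        by (rule cyclically_reduced_inv_word)
      then have "mink base_vec (x_zero (linear_word M (inv_word (ls @ [(Gen_g, False)])))) > 0"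
        by (rule base_vec_positive[OF _ _ ls', of _ "[]"]) simp_all
      then show ?thesis
        using contribution_False[of ls "[]"] ad Nil False by (simp add: edge_def bs)
    qed
  next
    case (Cons b r2)
    obtain s' ks where b: "b = (s', ks)" by (cases b)
    have rot: "rotate1 bs = (s', ks) # r2 @ [(s, ls)]"
      by (simp add: bs Cons b)
    let ?v = "ks @ block_word r2"
    have cF: "contribution (rotate1 bs) = mink base_vec (x_zero (linear_word M
        ((Gen_g, True) # inv_word ls @ (Gen_g, \<not> s) # inv_word ?v)))" if "\<not> s'"
      using contribution_False[of ks "r2 @ [(s, ls)]"] ad' that
      by (simp add: rot block_def)
    have cyc2: "cyclically_reduced ((Gen_g, True) # inv_word ls @ (Gen_g, \<not> s) # inv_word ?v)"
      if "\<not> s'"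
    proof -
      have "cyclically_reduced ([(Gen_g, s)] @ ls @ [(Gen_g, False)] @ ?v)"
        using cyc that by (simp add: bs Cons b block_def)
      then have "cyclically_reduced (?v @ [(Gen_g, s)] @ ls @ [(Gen_g, False)])"
        using cyclically_reduced_rotate[of "[(Gen_g, s)] @ ls @ [(Gen_g, False)]" ?v] by simp
      from cyclically_reduced_inv_word[OF this] show ?thesis by simp
    qed
    show ?thesis
    proof (cases s')
      case True
      then have "s" using assms(2) by (simp add: bs Cons b)
      then show ?thesis using T True by (simp add: edge_def bs Cons b)
    next
      case s': False
      show ?thesis
      proof (cases s)
        case False
        have "contribution (rotate1 bs) > 0"
          unfolding cF[OF s'] 
          by (rule base_vec_positive[OF cyc2[OF s'] _ ls', of "(Gen_g, True) # inv_word ?v"])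
            (simp_all add: False)
        then show ?thesis
          using False s' by (simp add: edge_def rot) (simp add: bs)
      next
        case True
        have "reduced (block_word bs)"
          using cyc by (simp add: cyclically_reduced_iff)
        then have red: "reduced ((Gen_g, True) # ls @ (Gen_g, False) # ?v)"
          using True s' by (simp add: bs Cons b block_def)
        \<comment> \<open>Otherwise \<open>g\<close> would stand next to its inverse. This provides
          the exponent \<open>i\<close> of at least one that \<open>W_set\<close> requires.\<close>
        then have "ls \<noteq> []"
          by (auto simp: reduced_iff)
        have "reduced ls"
          using red by (auto simp: reduced_iff successively_Cons successively_append_iff)
        then obtain t where t: "ls = replicate (length ls) (Gen_h, t)"
          using ls by (rule reduced_single_generator)
        define i where "i = length ls"
        have i: "i \<ge> 1" "ls = replicate i (Gen_h, t)"
          using \<open>ls \<noteq> []\<close> t by (auto simp: i_def Suc_le_eq)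
        let ?w1 = "(Gen_g, True) # ls @ (Gen_g, False) # ?v"
        let ?w2 = "(Gen_g, True) # inv_word ls @ (Gen_g, False) # inv_word ?v"
        have "cyclically_reduced ?w1" "cyclically_reduced ?w2"
          using cyc cyc2[OF s'] True s' by (simp_all add: bs Cons b block_def)
        moreover have "?w1 = [(Gen_g, True)] @ replicate i (Gen_h, t) @ [(Gen_g, False)] @ ?v"
          "?w2 = [(Gen_g, True)] @ replicate i (Gen_h, \<not> t) @ [(Gen_g, False)] @ inv_word ?v"
          using i by simp_all
        ultimately have "?w1 \<in> W_set t" "?w2 \<in> W_set (\<not> t)"
          unfolding W_set_def using i(1) by blast+
        \<comment> \<open>The sign \<open>t\<close> only decides which of the two words plays the
          role of the positive one.\<close>
        then have "mink base_vec (x_zero (linear_word M ?w1)) + mink base_vec (x_zero (linear_word M ?w2)) > 0"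
          using property_C[of ?w1 ?w2] property_C[of ?w2 ?w1] by (cases t) (simp_all add: add.commute)
        moreover have "contribution bs = mink base_vec (x_zero (linear_word M ?w1))"
          using contribution_True[OF ad] True s' by (simp add: bs Cons b block_def)
        ultimately show ?thesis
          using True s' cF[OF s'] by (simp add: edge_def rot) (simp add: bs)
      qed
    qed
  qed
qed

text \<open>The contributions of the inverse letters are reindexed by one cyclic step, so that each
  is counted with the preceding block.\<close>

lemma margulis_word_blocks:
  assumes ad: "admissible bs"
  shows "margulis_word base_deform (block_word bs) = (\<Sum>j<length bs. edge (rotate j bs))"
proof -
  have ne: "bs \<noteq> []" "cyclically_reduced (block_word bs)" "block_word bs \<noteq> []"
    using ad by (cases bs; auto simp: admissible_def block_def)+
  let ?c = "\<lambda>j. contribution (rotate j bs)"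
  let ?s = "\<lambda>j. fst (hd (rotate j bs))"
  have shift: "(\<Sum>j<length bs. f (rotate (Suc j) bs)) = (\<Sum>j<length bs. f (rotate j bs))"
    for f :: "(bool \<times> gen word) list \<Rightarrow> real"
  proof -
    obtain m where m: "length bs = Suc m"
      using ne by (cases bs) auto
    have "rotate (Suc m) bs = bs"
      using rotate_length01 rotate_id[of "Suc m" bs] m by simp
    then have "(\<Sum>j<Suc m. f (rotate (Suc j) bs)) = (\<Sum>j<m. f (rotate (Suc j) bs)) + f (rotate 0 bs)"
      by simp
    also have "\<dots> = (\<Sum>j<Suc m. f (rotate j bs))"
      by (simp add: sum.lessThan_Suc_shift add.commute del: sum.lessThan_Suc)
    finally show ?thesis by (simp only: m)
  qed
  have "margulis_word base_deform (block_word bs) = (\<Sum>j<length bs. ?c j)"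
    using margulis_word_concat[OF hyperbolic_word[OF ne(2,3)], of base_deform] ne(1)
    by (simp add: contribution_def rotate_map hd_map)
  also have "\<dots> = (\<Sum>j<length bs. if ?s j then ?c j else 0) + (\<Sum>j<length bs. if ?s j then 0 else ?c j)"
    by (subst sum.distrib[symmetric]) (intro sum.cong; simp)
  also have "(\<Sum>j<length bs. if ?s j then 0 else ?c j)
      = (\<Sum>j<length bs. if ?s (Suc j) then 0 else ?c (Suc j))"
    by (rule shift[of "\<lambda>xs. if fst (hd xs) then 0 else contribution xs", symmetric])
  also have "(\<Sum>j<length bs. if ?s j then ?c j else 0) + \<dots> = (\<Sum>j<length bs. edge (rotate j bs))"
    unfolding sum.distrib[symmetric] edge_def rotate_Suc by (rule refl)
  finally show ?thesis .
qed

lemma margulis_word_positive: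
  assumes ad: "admissible bs"
  shows "margulis_word base_deform (block_word bs) > 0"
  unfolding margulis_word_blocks[OF ad]
proof -
  let ?s = "\<lambda>j. fst (hd (rotate j bs))"
  have len: "length bs > 0"
    using ad by (simp add: admissible_def)
  have pos: "edge (rotate j bs) > 0" if "?s j \<or> \<not> ?s (Suc j)" for j
    using edge_positive[OF admissible_rotate[OF ad], of j] that by simp
  have nonneg: "edge (rotate j bs) \<ge> 0" for j
  proof (cases "?s j \<or> \<not> ?s (Suc j)")
    case True
    then show ?thesis using pos by (simp add: less_imp_le)
  next
    case False
    then show ?thesis by (simp add: edge_def)
  qed
  \<comment> \<open>If position zero fails, it carries an inverse letter followed by
    \<open>g\<close>. Then there are at least two blocks, and position one succeeds.\<close>
  have "\<exists>j<length bs. ?s j \<or> \<not> ?s (Suc j)"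
  proof (rule ccontr)
    assume n: "\<not> ?thesis"
    then have 0: "\<not> ?s 0" "?s (Suc 0)"
      using len by auto
    show False
    proof (cases "length bs = 1")
      case True
      then have "rotate (Suc 0) bs = bs"
        by (simp add: rotate_length01)
      then show False using 0 by simp
    next
      case False
      then have "Suc 0 < length bs" using len by linarith
      then show False using n 0 by blast
    qed
  qed
  then obtain j where "j < length bs" "?s j \<or> \<not> ?s (Suc j)"
    by blast
  then show "(\<Sum>j<length bs. edge (rotate j bs)) > 0"
    using pos nonneg by (intro sum_pos2[of "{..<length bs}" j]) auto
qed

end

subsection \<open>Perturbation\<close>

text \<open>The coordinates of the cross product are bounded on the circle, so an axis is long only
  if its two rays are close.\<close>

lemma norm_null_axis_le:
  assumes "a \<in> future_rays" "b \<in> future_rays" "\<delta> > 0" "mink a b \<le> - \<delta>"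
  shows "norm (null_axis a b) \<le> 6 / \<delta>"
proof -
  have c: "\<bar>a $ i\<bar> \<le> 1" "\<bar>b $ i\<bar> \<le> 1" for i
    using component_le_norm_cart[of a i] component_le_norm_cart[of b i] assms
    by (simp_all add: future_raysD)
  have m: "\<bar>a $ i * b $ j - a $ k * b $ l\<bar> \<le> 2" for i j k l
  proof -
    have "\<bar>a $ i * b $ j\<bar> \<le> 1" "\<bar>a $ k * b $ l\<bar> \<le> 1"
      by (simp_all add: abs_mult c mult_le_one)
    then show ?thesis by linarith
  qed
  have "norm (mink_cross a b) \<le> \<bar>mink_cross a b $ 1\<bar> + \<bar>mink_cross a b $ 2\<bar> + \<bar>mink_cross a b $ 3\<bar>"
    using norm_le_l1_cart[of "mink_cross a b"] by (simp add: sum_3)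
  also have "\<dots> \<le> 2 + 2 + 2"
    unfolding mink_cross_def vector_3 by (intro add_mono m)
  finally have "norm (mink_cross a b) \<le> 6" by simp
  moreover have "0 \<le> 1 / - mink a b"
    using assms by simp
  moreover have "1 / - mink a b \<le> 1 / \<delta>"
    by (rule frac_le) (use assms in auto)
  ultimately have "(1 / - mink a b) * norm (mink_cross a b) \<le> (1 / \<delta>) * 6"
    using assms by (intro mult_mono) auto
  then show ?thesis
    using assms by (simp add: null_axis_def)
qed

lemma continuous_on_matrix_vector [continuous_intros]:
  fixes M :: "real^'n^'m"
  assumes "continuous_on S f"
  shows "continuous_on S (\<lambda>x. M *v f x)"
  by (rule continuous_on_compose2[where t = UNIV, OF linear_continuous_on[OF matrix_vector_mul_bounded_linear] assms])
    simp

context lorentz_family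
begin

lemma continuous_word_translation:
  assumes "\<And>i. continuous_on UNIV (\<lambda>p. v p i)"
  shows "continuous_on UNIV (\<lambda>p. word_translation M (v p) w)"
proof (induction w)
  case (Cons l w)
  have "continuous_on UNIV (\<lambda>p. letter_translation M (v p) l)"
    unfolding letter_translation_def
    by (cases "snd l") (auto intro!: continuous_intros assms)
  then show ?case
    by (auto intro!: continuous_intros Cons.IH)
qed simp

lemma continuous_margulis_word:
  assumes "\<And>i. continuous_on UNIV (\<lambda>p. v p i)"
  shows "continuous_on UNIV (\<lambda>p. margulis_word (v p) w)"
  unfolding margulis_word_def by (intro continuous_intros continuous_word_translation assms)

lemma hyp_frame_power:
  assumes H: "hyp_frame (letter_matrix M l) a b \<mu>" and "k \<ge> 1"
  shows "hyp_frame (linear_word M (replicate k l)) a b (\<mu> ^ k)"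
proof -
  note D = hyp_frameD[OF H]
  have "linear_word M (replicate k l) *v b = \<mu> ^ k *\<^sub>R b"
    by (induction k) (simp_all add: matrix_vector_mul_assoc[symmetric] mat_vec_simps D mult.commute)
  moreover have "linear_word M (replicate k l) *v a = inverse (\<mu> ^ k) *\<^sub>R a"
    by (induction k) (simp_all add: matrix_vector_mul_assoc[symmetric] mat_vec_simps D mult.commute)
  moreover have "\<mu> ^ k > 1"
    using D(4) assms(2) by (simp add: one_less_power)
  ultimately show ?thesis
    using D by (simp add: hyp_frame_def)
qed

text \<open>Inverting the generator negates both its axis and its translation, so both signs of
  exponent give the same positive multiple of \<open>\<delta>\<close>.\<close>

lemma margulis_word_power:
  assumes H: "hyperbolic (M i)" and v: "v i = \<delta> *\<^sub>R x_zero (M i)" and k: "k \<ge> 1"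
  shows "margulis_word v (replicate k (i, s)) = of_nat k * \<delta>"
proof -
  let ?l = "(i, s)" and ?\<epsilon> = "if s then 1 else -1 :: real"
  have L: "hyperbolic (letter_matrix M ?l)" "x_zero (letter_matrix M ?l) = ?\<epsilon> *\<^sub>R x_zero (M i)"
    using H by (auto simp: letter_matrix_def hyperbolic_inv x_zero_inv)
  have t: "letter_translation M v ?l = \<delta> *\<^sub>R x_zero (letter_matrix M ?l)"
  proof (cases s)
    case True
    then show ?thesis by (simp add: letter_translation_def v letter_matrix_def)
  next
    case False
    have "matrix_inv (M i) *v x_zero (M i) = x_zero (M i)"
      using x_zero_fixed[OF H] lorentz_inv_cancel(2)[OF M] by metis
    then show ?thesis
      using False H by (simp add: letter_translation_def v letter_matrix_def x_zero_inv mat_vec_simps)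
  qed
  have "word_translation M v (replicate k ?l) = (of_nat k * \<delta>) *\<^sub>R x_zero (letter_matrix M ?l)"
    by (induction k) (simp_all add: t mat_vec_simps x_zero_fixed[OF L(1)] algebra_simps)
  moreover obtain a b \<mu> where F: "hyp_frame (letter_matrix M ?l) a b \<mu>"
    using L(1) by (auto simp: hyperbolic_def)
  have "x_zero (linear_word M (replicate k ?l)) = x_zero (letter_matrix M ?l)"
    using hyp_frame_x_zero[OF F] hyp_frame_x_zero[OF hyp_frame_power[OF F k]] by simp
  ultimately show ?thesis
    using x_zero_norm[OF L(1)] by (simp add: margulis_word_def)
qed

end

context property_C_schottky
begin

definition gh_word :: "nat \<Rightarrow> gen word" where
  "gh_word i = (Gen_g, True) # replicate i (Gen_h, True)"

lemma gh_word_nonempty: "gh_word i \<noteq> []"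
  by (simp add: gh_word_def)

lemma gh_word_cyclically_reduced: "cyclically_reduced (gh_word i)"
proof -
  have "successively (\<lambda>l k. l \<noteq> flip k) (replicate i (Gen_h, True))"
    by (induction i) (auto simp: successively_Cons hd_replicate)
  then show ?thesis
    by (cases "i = 0") (auto simp: gh_word_def cyclically_reduced_iff reduced_iff successively_Cons)
qed

text \<open>The axis of \<open>g h\<^sup>i\<close> converges to the one with endpoints \<open>g x\<^sub>h\<^sup>+\<close> and \<open>x\<^sub>h\<^sup>-\<close>, which is
  orthogonal to \<^const>\<open>base_vec\<close>.\<close>

lemma gh_word_limit:
  "\<exists>C\<ge>1. \<forall>i\<ge>1. norm (x_zero (linear_word M (gh_word i))) \<le> C"
  "(\<lambda>i. mink base_vec (x_zero (linear_word M (gh_word i)))) \<longlonglongrightarrow> 0"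
proof -
  let ?S = "sector (Gen_h, False) \<times> sector (Gen_g, True)"
  have "compact ?S" "?S \<noteq> {}"
    using sector_compact sector_nonempty by (auto intro: compact_Times)
  moreover have "continuous_on ?S (\<lambda>p. mink (fst p) (snd p))"
    by (intro continuous_intros)
  ultimately obtain p where p: "p \<in> ?S" "\<And>x. x \<in> ?S \<Longrightarrow> mink (fst x) (snd x) \<le> mink (fst p) (snd p)"
    using continuous_attains_sup[of ?S "\<lambda>p. mink (fst p) (snd p)"] by blast
  \<comment> \<open>Compactness makes the separation of the two disjoint sectors uniform. For every
    \<open>i\<close> of at least one they contain the fixed rays of
    \<open>gh_word i\<close>.\<close>
  define \<delta> where "\<delta> = - mink (fst p) (snd p)"
  have "mink (fst p) (snd p) < 0"
  proof (rule mink_future_rays_neg)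
    show "fst p \<in> future_rays" "snd p \<in> future_rays"
      using p(1) sector_subset unfolding mem_Times_iff by blast+
    show "fst p \<noteq> snd p"
      using p(1) sectors_distinct[of "fst p" "(Gen_h, False)" "snd p" "(Gen_g, True)"]
      unfolding mem_Times_iff by simp
  qed
  then have \<delta>: "\<delta> > 0" by (simp add: \<delta>_def)
  have sep: "mink a b \<le> - \<delta>" if "a \<in> sector (Gen_h, False)" "b \<in> sector (Gen_g, True)" for a b
    using p(2)[of "(a, b)"] that by (simp add: \<delta>_def)
  obtain \<nu> where Hh: "hyp_frame (M Gen_h) hm hp \<nu>"
    using hyp_frame_generator by metis
  note Dh = hyp_frameD[OF Hh]
  have Hh': "hyp_frame (letter_matrix M (Gen_h, True)) hm hp \<nu>"
    using Hh by (simp add: letter_matrix_def)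
  obtain \<kappa> where \<kappa>: "\<kappa> > 0" "M Gen_g *v hp = \<kappa> *\<^sub>R base_vec"
    using ray_action_scale[OF M Dh(3), of Gen_g] unfolding base_vec_def by metis
  let ?x = "\<lambda>i. x_zero (linear_word M (gh_word i))"
  have main: "norm (?x i) \<le> 6 / \<delta> \<and> (mink base_vec (?x i))\<^sup>2 \<le> 8 / (\<delta> * \<kappa>) * (inverse \<nu>) ^ i"
    if i: "i \<ge> 1" for i
  proof -
    obtain a b \<mu> where H: "hyp_frame (linear_word M (gh_word i)) a b \<mu>"
      and b: "b \<in> sector (hd (gh_word i))" and a: "a \<in> sector (flip (last (gh_word i)))"
      using hyp_frame_word[OF gh_word_cyclically_reduced gh_word_nonempty] .
    note D = hyp_frameD[OF H]
    have "last (gh_word i) = (Gen_h, True)"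
      using i by (simp add: gh_word_def)
    then have ab: "mink a b \<le> - \<delta>"
      using sep a b by (simp add: gh_word_def)
    have x: "?x i = null_axis a b"
      by (rule hyp_frame_x_zero[OF H])
    let ?H = "linear_word M (replicate i (Gen_h, True))"
    have Hhp: "?H *v hp = \<nu> ^ i *\<^sub>R hp"
      by (rule hyp_frameD(7)[OF hyp_frame_power[OF Hh' i]])
    have "M Gen_g *v (?H *v b) = \<mu> *\<^sub>R b"
      using D(7) by (simp add: gh_word_def letter_matrix_def matrix_vector_mul_assoc)
    \<comment> \<open>The pairing of \<open>hp\<close> with \<open>b\<close> is carried through the
      whole word. Since \<open>h\<close> expands \<open>hp\<close> by \<open>\<nu>\<close> each time
      and \<open>\<mu> > 1\<close>, \<open>mink base_vec b\<close> decays at least like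
      \<open>inverse \<nu> ^ i\<close>.\<close>
    then have "\<kappa> * (\<mu> * mink base_vec b) = mink (M Gen_g *v hp) (M Gen_g *v (?H *v b))"
      by (simp add: \<kappa>(2))
    also have "\<dots> = mink hp (?H *v b)"
      by (rule lorentz_mink[OF M])
    finally have "\<nu> ^ i * (\<kappa> * (\<mu> * mink base_vec b)) = mink (?H *v hp) (?H *v b)"
      by (simp add: Hhp)
    also have "\<dots> = mink hp b"
      by (rule lorentz_mink) simp
    finally have eq: "\<nu> ^ i * \<kappa> * (\<mu> * mink base_vec b) = mink hp b"
      by (simp add: mult.assoc)
    have \<nu>i: "\<nu> ^ i > 0" using Dh(4) by simp
    have "\<bar>mink base_vec b\<bar> \<le> \<mu> * \<bar>mink base_vec b\<bar>"
      using D(4) mult_right_mono[of 1 \<mu> "\<bar>mink base_vec b\<bar>"] by simp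
    then have "\<nu> ^ i * \<kappa> * \<bar>mink base_vec b\<bar> \<le> \<nu> ^ i * \<kappa> * (\<mu> * \<bar>mink base_vec b\<bar>)"
      using \<nu>i \<kappa>(1) by (intro mult_left_mono) auto
    also have "\<dots> = \<bar>mink hp b\<bar>"
      unfolding eq[symmetric] abs_mult using \<nu>i \<kappa>(1) D(4) by simp
    also have "\<dots> \<le> 2"
      by (rule mink_future_rays_bound[OF Dh(3) D(3)])
    finally have qb: "\<bar>mink base_vec b\<bar> \<le> 2 / (\<nu> ^ i * \<kappa>)"
      using \<nu>i \<kappa>(1) by (simp add: pos_le_divide_eq mult.commute)
    have qa: "\<bar>mink base_vec a\<bar> \<le> 2"
      by (rule mink_future_rays_bound[OF base_vec_future D(2)])
    \<comment> \<open>In the Gram formula \<open>mink base_vec b\<close> is the small factor; the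
      denominator \<open>mink a b\<close> stays away from zero, so the square of the pairing
      inherits the decay.\<close>
    have "(det3 base_vec a b)\<^sup>2 = - 2 * mink base_vec a * mink a b * mink b base_vec"
      using base_vec_future D by (intro det3_square_lightlike) (auto simp: future_raysD)
    then have "(mink base_vec (?x i))\<^sup>2 = 2 * (mink base_vec a * mink base_vec b) / - mink a b"
      using ab \<delta> by (simp add: x mink_null_axis power_divide power2_eq_square mink_commute[of b] field_simps)
    also have "\<dots> \<le> 2 * (2 * (2 / (\<nu> ^ i * \<kappa>))) / \<delta>"
    proof (intro frac_le mult_left_mono)
      have "mink base_vec a * mink base_vec b \<le> \<bar>mink base_vec a\<bar> * \<bar>mink base_vec b\<bar>"
        by (simp add: abs_mult[symmetric])
      also have "\<dots> \<le> 2 * (2 / (\<nu> ^ i * \<kappa>))"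
        using qa qb by (intro mult_mono) auto
      finally show "mink base_vec a * mink base_vec b \<le> 2 * (2 / (\<nu> ^ i * \<kappa>))" .
    qed (use ab \<delta> \<nu>i \<kappa>(1) in auto)
    also have "\<dots> = 8 / (\<delta> * \<kappa>) * (inverse \<nu>) ^ i"
      by (simp add: power_inverse field_simps)
    finally have "(mink base_vec (?x i))\<^sup>2 \<le> 8 / (\<delta> * \<kappa>) * (inverse \<nu>) ^ i" .
    moreover have "norm (?x i) \<le> 6 / \<delta>"
      unfolding x by (rule norm_null_axis_le[OF D(2,3) \<delta> ab])
    ultimately show ?thesis by blast
  qed
  have "(\<lambda>i. (inverse \<nu>) ^ i) \<longlonglongrightarrow> 0"
    using Dh(4) by (intro LIMSEQ_realpow_zero) (auto simp: inverse_less_1_iff)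
  then have lim0: "(\<lambda>i. 8 / (\<delta> * \<kappa>) * (inverse \<nu>) ^ i) \<longlonglongrightarrow> 0"
    by (rule tendsto_mult_right_zero)
  have "(\<lambda>i. (mink base_vec (?x i))\<^sup>2) \<longlonglongrightarrow> 0"
  proof (rule tendsto_sandwich[OF _ _ tendsto_const lim0])
    show "\<forall>\<^sub>F i in sequentially. (mink base_vec (?x i))\<^sup>2 \<le> 8 / (\<delta> * \<kappa>) * (inverse \<nu>) ^ i"
      using main by (auto simp: eventually_sequentially)
  qed simp
  then have "(\<lambda>i. sqrt ((mink base_vec (?x i))\<^sup>2)) \<longlonglongrightarrow> sqrt 0"
    by (rule tendsto_real_sqrt)
  then show "(\<lambda>i. mink base_vec (?x i)) \<longlonglongrightarrow> 0"
    by (simp add: tendsto_rabs_zero_iff)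
  have "norm (?x i) \<le> max 1 (6 / \<delta>)" if "i \<ge> 1" for i
    using main[OF that] by linarith
  then show "\<exists>C\<ge>1. \<forall>i\<ge>1. norm (?x i) \<le> C"
    by (intro exI[of _ "max 1 (6 / \<delta>)"]) simp
qed

text \<open>Positivity on finitely many words is an open condition, so it survives in a ball around
  the base deformation. Within that ball the invariant of one far \<open>gh_word i\<close> can be
  corrected to zero.\<close>

lemma exists_deformation:
  obtains v i where "margulis_word v (gh_word i) = 0"
    "\<And>w. cyclically_reduced w \<Longrightarrow> w \<noteq> [] \<Longrightarrow> length w \<le> n \<Longrightarrow> margulis_word v w > 0"
proof -
  \<comment> \<open>Rotation moves a letter of \<open>g\<close> to the front, so \<open>S\<close>
    accounts for all short words except powers of \<open>h\<close>. On those powers the base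
    deformation gives zero, and \<open>\<delta>\<close> treats them separately.\<close>
  define S where "S = {w. cyclically_reduced w \<and> length w \<le> n \<and> w \<noteq> [] \<and> fst (hd w) = Gen_g}"
  have "finite {w :: gen word. set w \<subseteq> UNIV \<and> length w \<le> n}"
    by (rule finite_lists_length_le) simp
  then have finS: "finite S"
    by (rule finite_subset[rotated]) (auto simp: S_def)
  let ?v = "\<lambda>p. case_gen (fst p) (snd p) :: gen \<Rightarrow> real^3"
  let ?U = "\<Inter>w\<in>S. {p. margulis_word (?v p) w > 0}"
  have "continuous_on UNIV (\<lambda>p. ?v p i)" for i
    by (cases i) (auto intro: continuous_intros)
  then have "open ?U"
    using finS by (intro open_INT ballI open_Collect_less continuous_intros continuous_margulis_word)
  moreover have "(base_vec, 0) \<in> ?U"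
  proof (rule INT_I)
    fix w assume w: "w \<in> S"
    then obtain l u where lu: "w = l # u" "fst l = Gen_g"
      by (cases w) (auto simp: S_def)
    obtain bs where bs: "bs \<noteq> []" "l # u = block_word bs"
        "\<forall>b \<in> set bs. \<forall>k \<in> set (snd b). fst k = Gen_h"
      using blocks_exist[OF lu(2)] .
    then have "admissible bs"
      using w lu by (simp add: admissible_def S_def)
    then show "(base_vec, 0) \<in> {p. margulis_word (?v p) w > 0}"
      using margulis_word_positive bs(2) lu(1) by (simp add: base_deform_def)
  qed
  ultimately obtain \<eta> where \<eta>: "\<eta> > 0" "ball (base_vec, 0) \<eta> \<subseteq> ?U"
    by (rule openE)
  obtain C where C: "C \<ge> 1" "\<And>i. i \<ge> 1 \<Longrightarrow> norm (x_zero (linear_word M (gh_word i))) \<le> C"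
    using gh_word_limit(1) by blast
  \<comment> \<open>The allowed displacement is \<open>\<eta>\<close>: less than a third is spent on
    cancelling \<open>a\<close>, and less than a third on \<open>\<delta>\<close>.\<close>
  have "\<eta> / (3 * C) > 0"
    using \<eta> C by simp
  then obtain N where N: "\<And>i. i \<ge> N \<Longrightarrow> norm (mink base_vec (x_zero (linear_word M (gh_word i))) - 0) < \<eta> / (3 * C)"
    using LIMSEQ_D[OF gh_word_limit(2)] by blast
  define i where "i = max 1 N"
  define X where "X = x_zero (linear_word M (gh_word i))"
  define a where "a = mink base_vec X"
  have a: "\<bar>a\<bar> * C < \<eta> / 3"
    using N[of i] C(1) by (simp add: i_def a_def X_def field_simps)
  have XC: "norm X \<le> C"
    using C(2)[of i] by (simp add: i_def X_def)
  have XX: "mink X X = 1"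
    unfolding X_def
    by (rule x_zero_norm[OF hyperbolic_word[OF gh_word_cyclically_reduced]]) (simp add: gh_word_def)
  define Y where "Y = x_zero (M Gen_h)"
  have hh: "hyperbolic (M Gen_h)"
    using hyp_frame_generator unfolding hyperbolic_def by metis
  \<comment> \<open>The amount that the choice \<open>Y\<close> for the translation of
    \<open>h\<close> adds to the invariant of \<open>gh_word i\<close>.\<close>
  define D where "D = mink (M Gen_g *v word_translation M (case_gen 0 Y) (replicate i (Gen_h, True))) X"
  have h_part: "word_translation M (case_gen x (\<delta> *\<^sub>R Y)) (replicate k (Gen_h, True))
      = \<delta> *\<^sub>R word_translation M (case_gen 0 Y) (replicate k (Gen_h, True))" for x \<delta> k
    by (induction k) (simp_all add: letter_translation_def mat_vec_simps scaleR_right_distrib)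
  have gh: "margulis_word (case_gen x (\<delta> *\<^sub>R Y)) (gh_word i) = mink x X + \<delta> * D" for x \<delta>
    unfolding margulis_word_def X_def[symmetric] D_def
    by (simp add: gh_word_def h_part letter_translation_def letter_matrix_def mat_vec_simps)
  define K where "K = \<bar>D\<bar> * C + norm Y + 1"
  define \<delta> where "\<delta> = \<eta> / (3 * K)"
  have K: "K > 0"
    using C(1) by (simp add: K_def add_nonneg_pos)
  then have \<delta>: "\<delta> > 0"
    using \<eta> by (simp add: \<delta>_def)
  have "\<delta> * K = \<eta> / 3"
    using K by (simp add: \<delta>_def)
  then have small: "\<delta> * (\<bar>D\<bar> * C) + \<delta> * norm Y < \<eta> / 3"
    using \<delta> by (simp add: K_def distrib_left)
  \<comment> \<open>As \<open>mink X X = 1\<close>, this multiple of \<open>X\<close> removes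
    exactly the value \<open>a + \<delta> * D\<close>, and the bound \<open>C\<close> on
    \<open>X\<close> keeps the change small.\<close>
  define x where "x = base_vec - (a + \<delta> * D) *\<^sub>R X"
  let ?w = "case_gen x (\<delta> *\<^sub>R Y)"
  have "norm (base_vec - x) = \<bar>a + \<delta> * D\<bar> * norm X"
    by (simp add: x_def)
  also have "\<dots> \<le> (\<bar>a\<bar> + \<delta> * \<bar>D\<bar>) * C"
    using XC \<delta> by (intro mult_mono) (auto simp: abs_mult intro: order_trans[OF abs_triangle_ineq])
  also have "\<dots> = \<bar>a\<bar> * C + \<delta> * (\<bar>D\<bar> * C)"
    by (simp add: algebra_simps)
  finally have nx: "norm (base_vec - x) \<le> \<bar>a\<bar> * C + \<delta> * (\<bar>D\<bar> * C)" .
  have "dist (base_vec, 0) (x, \<delta> *\<^sub>R Y) \<le> norm (base_vec - x) + norm (\<delta> *\<^sub>R Y)"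
    using norm_Pair_le[of "base_vec - x" "0 - \<delta> *\<^sub>R Y"] by (simp add: dist_norm)
  also have "\<dots> < \<eta>"
    using nx small a \<delta> \<eta>(1) by simp
  finally have "(x, \<delta> *\<^sub>R Y) \<in> ?U"
    using \<eta>(2) by (auto simp: mem_ball)
  then have S_pos: "margulis_word ?w w > 0" if "w \<in> S" for w
    using that by auto
  show ?thesis
  proof (rule that)
    show "margulis_word ?w (gh_word i) = 0"
      unfolding gh by (simp add: x_def XX a_def)
    fix w :: "gen word"
    assume w: "cyclically_reduced w" "w \<noteq> []" "length w \<le> n"
    show "margulis_word ?w w > 0"
    proof (cases "\<exists>l \<in> set w. fst l = Gen_g")
      case True
      then obtain l u u' where l: "w = u @ l # u'" "fst l = Gen_g"
        by (meson split_list)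
      have "cyclically_reduced ((l # u') @ u)"
        using cyclically_reduced_rotate w l by metis
      then have "(l # u') @ u \<in> S"
        using w l by (simp add: S_def)
      then have "margulis_word ?w ((l # u') @ u) > 0"
        by (rule S_pos)
      then show ?thesis
        using margulis_word_rotate[of u "l # u'"] hyperbolic_word[OF w(1,2)] unfolding l(1) by metis
    next
      case False
      then have "\<forall>l \<in> set w. fst l = Gen_h"
        using gen.exhaust by blast
      moreover have "reduced w"
        using w by (simp add: cyclically_reduced_def)
      ultimately obtain s where s: "w = replicate (length w) (Gen_h, s)"
        using reduced_single_generator by metis
      have "length w \<ge> 1"
        using w by (simp add: Suc_le_eq)
      then have "margulis_word ?w (replicate (length w) (Gen_h, s)) = of_nat (length w) * \<delta>"
        using margulis_word_power[OF hh] by (simp add: Y_def)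
      then show ?thesis
        using s \<delta> w by simp
    qed
  qed
qed

end

section \<open>Non-proper deformations with positive invariants on short words\<close>

theorem theorem1p1:
  fixes g h :: "real^3^3"
    and A :: "gen \<Rightarrow> bool \<Rightarrow> (real^3) set"
    and n :: nat
  assumes "g \<in> SO21_0" and "h \<in> SO21_0"
    and "schottky_system (case_gen g h) A"
    and "transversal g h"
    and "positive_triple (x_minus g) (x_minus h) (x_plus g)"
    and "property_C g h A"
    and "n \<ge> 1"
  shows "\<exists>v_g v_h :: real^3.
    let gs = case_gen (affine_map g v_g) (affine_map h v_h) in
      \<not> acts_properly (affine_group gs) \<and>
      (\<forall>\<omega> \<in> affine_group gs. \<omega> \<noteq> id \<and> word_length gs \<omega> \<le> n \<longrightarrow> margulis \<omega> > 0)"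
proof -
  define M where "M = case_gen g h"
  have M: "M i \<in> lorentz" for i
    using assms(1,2) SO21_0_subset_lorentz by (cases i) (auto simp: M_def)
  interpret crossing_schottky M A
    by unfold_locales (use M assms in \<open>simp_all add: M_def\<close>)
  have base: "base_vec = ray_action g (x_plus h)"
    unfolding base_vec_def by (simp add: M_def)
  obtain I where I: "closed_conical_interval I"
      "rays_topology frontier_of I = {x_plus (g ** h), ray_action g (x_plus h)}"
      "\<And>x w1 w2. future_lightlike x \<Longrightarrow> ray x \<in> I \<Longrightarrow> w1 \<in> W_set True \<Longrightarrow> w2 \<in> W_set False
        \<Longrightarrow> - mink x (x_zero (linear_word M w1)) < mink x (x_zero (linear_word M w2))"
    using assms(6) unfolding property_C_def M_def by metis
  \<comment> \<open>A closed interval contains its endpoints, so Property C applies to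
    \<open>base_vec\<close> itself.\<close>
  have "base_vec \<in> I"
    using frontier_of_subset_closedin[of rays_topology I] I(1,2)
    by (auto simp: closed_conical_interval_def base)
  then interpret property_C_schottky M A
    using I(3)[of base_vec] base_vec_future
    by unfold_locales (force simp: ray_future_ray future_raysD)
  obtain v i where v: "margulis_word v (gh_word i) = 0"
    "\<And>w. cyclically_reduced w \<Longrightarrow> w \<noteq> [] \<Longrightarrow> length w \<le> n \<Longrightarrow> margulis_word v w > 0"
    using exists_deformation[of n] by metis
  define F where "F = (\<lambda>i. affine_map (M i) (v i))"
  have F: "case_gen (affine_map g (v Gen_g)) (affine_map h (v Gen_h)) = F"
    by (rule ext) (simp add: F_def M_def split: gen.split)
  have F_word: "affine_word F w = affine_map (linear_word M w) (word_translation M v w)" for w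
    unfolding F_def by (rule affine_word_eq) (rule M)
  have margulis_F: "margulis (affine_word F w) = margulis_word v w" for w
    unfolding F_def by (rule margulis_affine_word)
  have "\<not> acts_properly (affine_group F)"
  proof -
    obtain a b \<mu> where H: "hyp_frame (linear_word M (gh_word i)) a b \<mu>"
      using hyp_frame_word[OF gh_word_cyclically_reduced gh_word_nonempty] by metis
    have "affine_word F (gh_word i) ^^ k = affine_word F (concat (replicate k (gh_word i)))" for k
      by (induction k) (simp_all add: affine_word_append)
    then have "(affine_word F (gh_word i) ^^ k) \<in> affine_group F" for k
      by (simp add: affine_group_def)
    then show ?thesis
      using not_acts_properly_of_margulis_zero[OF H] v(1) margulis_F[of "gh_word i"]
      unfolding F_word by metis
  qed
  moreover have "margulis \<omega> > 0" if \<omega>: "\<omega> \<in> affine_group F" "\<omega> \<noteq> id" "word_length F \<omega> \<le> n" for \<omega>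
  proof -
    \<comment> \<open>Existence of some representing word ensures that the minimum in
      \<open>word_length\<close> is attained by a word, which is then replaced by a cyclically
      reduced conjugate no longer than it.\<close>
    have "\<exists>k w. length w = k \<and> affine_word F w = \<omega>"
      using \<omega>(1) by (auto simp: affine_group_def)
    then have "\<exists>w. length w = word_length F \<omega> \<and> affine_word F w = \<omega>"
      unfolding word_length_def by (rule LeastI_ex)
    then obtain w where len: "length w = word_length F \<omega>" and "affine_word F w = \<omega>"
      by blast
    then have w: "length w \<le> n" "affine_word F w = \<omega>"
      using \<omega>(3) by simp_all
    have bij: "bij (F j)" for j
      unfolding F_def by (rule affine_map_inverse(2)[OF M])
    obtain p u where pu: "cyclically_reduced u" "length u \<le> length w"
      "affine_word F w = affine_word F p \<circ> affine_word F u \<circ> inv (affine_word F p)"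
      using cyclic_reduction[of F w] bij by metis
    have "u \<noteq> []"
    proof
      assume "u = []"
      then have "\<omega> = affine_word F p \<circ> inv (affine_word F p)"
        using pu(3) w(2) by simp
      also have "\<dots> = id"
        by (rule surj_iff[THEN iffD1, OF bij_is_surj[OF affine_word_bij[OF bij]]])
      finally show False using \<omega>(2) by simp
    qed
    then have "margulis_word v u > 0"
      using v(2)[of u] pu w by simp
    moreover have "margulis \<omega> = margulis (affine_word F u)"
      unfolding w(2)[symmetric] pu(3) unfolding F_word
      by (rule margulis_conj[OF hyperbolic_word[OF pu(1) \<open>u \<noteq> []\<close>]]) simp
    ultimately show ?thesis
      by (simp add: margulis_F)
  qed
  ultimately show ?thesis
    unfolding Let_def by (intro exI[of _ "v Gen_g"] exI[of _ "v Gen_h"]) (auto simp: F)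
qed

end
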